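(* Let $s>0$ and let $\Omega\subset\mathbb{R}$ be a non-empty open set that is invariant under translations by elements of $2\pi\mathbb{Z}$. Then there exists a constant $C>0$, independent of $\lambda$, $u$ and $f$, such that for all real $\lambda\ge 1$ and all $u\in H^s(\mathbb{R})$, $f\in L^2(\mathbb{R})$ with $$\big((-\partial_{xx})^{s/2}-\lambda\big)u=f\quad\text{on }\mathbb{R},$$ one has $$\|u\|_{L^2(\mathbb{R})}\le C\left(\langle\lambda\rangle^{\frac1s-1}\|f\|_{L^2(\mathbb{R})}+\|u\|_{L^2(\Omega)}\right).$$
   Context: Functions are complex-valued. $\langle\lambda\rangle=(1+|\lambda|^2)^{1/2}$. The operator $(-\partial_{xx})^{s/2}$ on $\mathbb{R}$ is the Fourier multiplier $\widehat{(-\partial_{xx})^{s/2}f}(\xi)=|\xi|^s\hat f(\xi)$, and $H^s(\mathbb{R})$ is the Sobolev space with norm given by $\|f\|_{H^s}^2=\int_{\mathbb{R}}(1+\xi^2)^s|\hat f(\xi)|^2\,d\xi<\infty$. *)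

theory Defs
  imports "HOL-Analysis.Analysis"
begin

definition L2 :: "(real \<Rightarrow> complex) set" where
  "L2 = {f \<in> borel_measurable lebesgue. integrable lebesgue (\<lambda>x. (cmod (f x))\<^sup>2)}"

definition L2_norm_on :: "real set \<Rightarrow> (real \<Rightarrow> complex) \<Rightarrow> real" where
  "L2_norm_on A f = sqrt (LINT x:A|lebesgue. (cmod (f x))\<^sup>2)"

definition truncated_fourier :: "real \<Rightarrow> (real \<Rightarrow> complex) \<Rightarrow> real \<Rightarrow> complex" where
  "truncated_fourier R f \<xi> =
     complex_of_real (1 / sqrt (2 * pi)) *
     (LINT x:{-R..R}|lebesgue. exp (- (\<i> * complex_of_real (x * \<xi>))) * f x)"

(* The Fourier-Plancherel transform as a relation, since L2 functions are represented by
   pointwise functions and g is determined only up to null sets: g is the limit in L2, as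
   R tends to infinity, of the transforms of the restrictions of f to [-R, R] (which are
   integrable).  The distance is an extended nonnegative integral, so that no
   non-integrable difference can be mistaken for a small one.  The kernel exp(-ix\<xi>)
   makes -d^2/dx^2 the multiplier \<xi>^2; the factor 1/sqrt(2 pi) makes the transform
   unitary. *)
definition has_fourier :: "(real \<Rightarrow> complex) \<Rightarrow> (real \<Rightarrow> complex) \<Rightarrow> bool" where
  "has_fourier f g \<longleftrightarrow> f \<in> L2 \<and> g \<in> L2 \<and>
     ((\<lambda>R. \<integral>\<^sup>+ \<xi>. ennreal ((cmod (truncated_fourier R f \<xi> - g \<xi>))\<^sup>2) \<partial>lebesgue) \<longlongrightarrow> 0) at_top"

definition sobolev :: "real \<Rightarrow> (real \<Rightarrow> complex) set" where
  "sobolev s = {f. \<exists>g. has_fourier f g \<and>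
     integrable lebesgue (\<lambda>\<xi>. (1 + \<xi>\<^sup>2) powr s * (cmod (g \<xi>))\<^sup>2)}"

(* v represents (-d^2/dx^2)^(s/2) u; for u in sobolev s such a v exists in L2 and is
   unique up to null sets. *)
definition has_frac_laplacian ::
    "real \<Rightarrow> (real \<Rightarrow> complex) \<Rightarrow> (real \<Rightarrow> complex) \<Rightarrow> bool" where
  "has_frac_laplacian s u v \<longleftrightarrow>
     (\<exists>g. has_fourier u g \<and> has_fourier v (\<lambda>\<xi>. complex_of_real (\<bar>\<xi>\<bar> powr s) * g \<xi>))"

definition japanese_bracket :: "real \<Rightarrow> real" where
  "japanese_bracket x = sqrt (1 + \<bar>x\<bar>\<^sup>2)"

end

theory Submission
  imports Defs "HOL-Probability.Probability"
begin

text \<open>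
  Put \<mu> = l powr (1 / s), so that \<mu> \<ge> 1, and let g be the Fourier transform of u. The equation
  says that the transform of f is (\<bar>\<xi>\<bar> powr s - \<mu> powr s) * g. At distance at least 1/5 from the two
  points \<plusminus>\<mu> this factor is at least a constant times \<mu> powr (s - 1) (lemma powr_gap), so
  Plancherel's identity controls the part of g there by \<mu> powr (1 - s) times the norm of f, and
  \<mu> powr (1 - s) = l powr (1 / s - 1). What remains is to control the part g1 of g that lives
  in the two short intervals around \<plusminus>\<mu> by the norm of u on \<Omega>, with a constant that does not
  depend on \<mu>.

  This is where the periodicity of \<Omega> enters. A trigonometric polynomial with integer frequencies,
  p x = (\<Sum> c k * exp (\<i> k x)), satisfies (\<integral> p * \<bar>u\<bar>^2) = (\<Sum> c k * \<integral> g (\<xi> - k) * cnj (g \<xi>)),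
  because multiplication by exp (\<i> k x) translates the Fourier transform by k (lemmas
  has_fourier_modulation and parseval). If Re p is at most the indicator function of \<Omega>, the
  real part of the left side is at most the squared norm of u on \<Omega>. On the right side replace g by g1,
  at a price that involves g - g1 and an arbitrarily small multiple of g1
  (lemma shift_form_perturbation). An integer translate of the two intervals that differs
  from them can meet them only by carrying one onto the neighbourhood of the other, and
  since the intervals are short this happens for only one integer k in each direction.
  Hence the terms with k \<noteq> 0 contribute at most max \<bar>c k\<bar> times the squared norm of g1, whatever \<mu> is
  (lemma sum_shift_form_shell), and the sum is at least (Re (c 0) - max \<bar>c k\<bar>) times it. So it
  is enough that Re (c 0) strictly exceeds all other \<bar>c k\<bar>: a high power of a raised cosine centred at a
  point of \<Omega>, lowered by a small constant, has this property (lemma trigonometric_minorant).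

  The transform is given as an $L^2$ limit of truncated Fourier integrals. Plancherel's
  identity for it follows from the identity for integrable functions (lemma
  plancherel_integrable), which is obtained by damping the spectrum with a Gaussian: the
  damped energy is a Gaussian average of the autocorrelation of the function near 0, and
  the autocorrelation is continuous at 0 because translations are continuous in $L^2$.
\<close>

section \<open>Square-integrable functions\<close>

text \<open>
  Borel measurability is required, rather than Lebesgue measurability as in L2, because the
  arguments below use product measures. Every element of L2 agrees almost everywhere with such
  a function.
\<close>

definition square_integrable :: "(real \<Rightarrow> complex) \<Rightarrow> bool" where
  "square_integrable f \<longleftrightarrow> f \<in> borel_measurable borel \<and> integrable lborel (\<lambda>x. (cmod (f x))\<^sup>2)"

text \<open>
  The squared norm is used instead of the norm: most estimates below compare integrals pointwise,
  and Young's inequality takes the place of the triangle and Cauchy--Schwarz inequalities.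
\<close>

definition energy :: "(real \<Rightarrow> complex) \<Rightarrow> real" where
  "energy f = (\<integral>x. (cmod (f x))\<^sup>2 \<partial>lborel)"

lemma square_integrable_measurable [measurable_dest]:
  "square_integrable f \<Longrightarrow> f \<in> borel_measurable borel"
  by (simp add: square_integrable_def)

lemma energy_nonneg [simp]: "0 \<le> energy f"
  by (simp add: energy_def)

lemma square_integrable_dominated:
  assumes [measurable]: "f \<in> borel_measurable borel"
    and "integrable lborel w" and "\<And>x. (cmod (f x))\<^sup>2 \<le> w x"
  shows "square_integrable f"
  unfolding square_integrable_def
proof (intro conjI assms(1))
  show "integrable lborel (\<lambda>x. (cmod (f x))\<^sup>2)"
    by (rule Bochner_Integration.integrable_bound [OF assms(2)]) (use assms(3) in \<open>auto intro: order_trans [OF _ abs_ge_self]\<close>)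
qed

lemma cmod_add_squared_le_weighted:
  assumes "0 < \<eta>"
  shows "(cmod (a + b))\<^sup>2 \<le> (1 + \<eta>) * (cmod a)\<^sup>2 + (1 + 1 / \<eta>) * (cmod b)\<^sup>2"
proof -
  have "0 \<le> (\<eta> * cmod a - cmod b)\<^sup>2 / \<eta>"
    using assms by simp
  also have "\<dots> = \<eta> * (cmod a)\<^sup>2 + (1 / \<eta>) * (cmod b)\<^sup>2 - 2 * cmod a * cmod b"
    using assms by (simp add: power2_eq_square field_simps)
  finally have "(cmod a + cmod b)\<^sup>2 \<le> (1 + \<eta>) * (cmod a)\<^sup>2 + (1 + 1 / \<eta>) * (cmod b)\<^sup>2"
    by (simp add: power2_sum algebra_simps)
  then show ?thesis
    by (rule order_trans [OF power_mono [OF norm_triangle_ineq norm_ge_zero]])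
qed

lemma square_integrable_add:
  assumes f: "square_integrable f" and g: "square_integrable g"
  shows "square_integrable (\<lambda>x. f x + g x)"
proof (rule square_integrable_dominated)
  show "integrable lborel (\<lambda>x. 2 * (cmod (f x))\<^sup>2 + 2 * (cmod (g x))\<^sup>2)"
    using assms by (auto simp: square_integrable_def)
  show "(cmod (f x + g x))\<^sup>2 \<le> 2 * (cmod (f x))\<^sup>2 + 2 * (cmod (g x))\<^sup>2" for x
    using cmod_add_squared_le_weighted [of 1 "f x" "g x"] by simp
qed (use f g in measurable)

lemma square_integrable_mult_bounded:
  assumes "square_integrable f" and [measurable]: "p \<in> borel_measurable borel"
    and p: "\<And>x. cmod (p x) \<le> B"
  shows "square_integrable (\<lambda>x. p x * f x)"
proof (rule square_integrable_dominated)
  show "integrable lborel (\<lambda>x. B\<^sup>2 * (cmod (f x))\<^sup>2)"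
    using assms by (auto simp: square_integrable_def)
  show "(cmod (p x * f x))\<^sup>2 \<le> B\<^sup>2 * (cmod (f x))\<^sup>2" for x
    by (simp add: norm_mult power_mult_distrib mult_right_mono power_mono p)
qed (use assms(1) in measurable)

lemma square_integrable_cmult: "square_integrable f \<Longrightarrow> square_integrable (\<lambda>x. c * f x)"
  by (rule square_integrable_mult_bounded [where B = "cmod c"]) auto

lemma square_integrable_diff:
  assumes "square_integrable f" and "square_integrable g"
  shows "square_integrable (\<lambda>x. f x - g x)"
  using square_integrable_add [OF assms(1) square_integrable_cmult [OF assms(2), of "-1"]] by simp

lemma square_integrable_indicator:
  assumes "square_integrable f" and [measurable]: "A \<in> sets borel"
  shows "square_integrable (\<lambda>x. indicator A x * f x)"
  by (rule square_integrable_mult_bounded [OF assms(1), where B = 1]) (auto simp: indicator_def)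

lemma square_integrable_translate:
  assumes "square_integrable f"
  shows "square_integrable (\<lambda>x. f (x + t))"
  using assms lborel_integrable_real_affine_iff [of 1 "\<lambda>x. (cmod (f x))\<^sup>2" t]
  by (auto simp: square_integrable_def add.commute)

lemma energy_translate: "energy (\<lambda>x. f (x + t)) = energy f"
  using lborel_integral_real_affine [of 1 "\<lambda>x. (cmod (f x))\<^sup>2" t]
  by (simp add: energy_def add.commute)

lemma energy_add_le_weighted:
  assumes f: "square_integrable f" and g: "square_integrable g" and "0 < \<eta>"
  shows "energy (\<lambda>x. f x + g x) \<le> (1 + \<eta>) * energy f + (1 + 1 / \<eta>) * energy g"
proof -
  have "energy (\<lambda>x. f x + g x) \<le> (\<integral>x. (1 + \<eta>) * (cmod (f x))\<^sup>2 + (1 + 1 / \<eta>) * (cmod (g x))\<^sup>2 \<partial>lborel)"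
    unfolding energy_def using f g square_integrable_add [OF f g] \<open>0 < \<eta>\<close>
    by (intro integral_mono) (auto simp: square_integrable_def cmod_add_squared_le_weighted)
  also have "\<dots> = (1 + \<eta>) * energy f + (1 + 1 / \<eta>) * energy g"
    using f g by (simp add: energy_def square_integrable_def)
  finally show ?thesis .
qed

lemma energy_add_le:
  assumes "square_integrable f" and "square_integrable g"
  shows "energy (\<lambda>x. f x + g x) \<le> 2 * energy f + 2 * energy g"
  using energy_add_le_weighted [OF assms, of 1] by simp

lemma energy_minus_commute: "energy (\<lambda>x. f x - g x) = energy (\<lambda>x. g x - f x)"
  by (simp add: energy_def norm_minus_commute)

section \<open>Continuity of translations in $L^2$\<close>

definition clamp_disc :: "real \<Rightarrow> complex \<Rightarrow> complex" where
  "clamp_disc B z = z / complex_of_real (max 1 (cmod z / B))"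

lemma cmod_clamp_disc_le: "0 < B \<Longrightarrow> cmod (clamp_disc B z) \<le> B"
  by (auto simp: clamp_disc_def norm_divide divide_simps max_def not_le split: if_splits)

lemma clamp_disc_id: "0 < B \<Longrightarrow> cmod z \<le> B \<Longrightarrow> clamp_disc B z = z"
  by (auto simp: clamp_disc_def max_def divide_simps)

lemma continuous_on_clamp_disc: "0 < B \<Longrightarrow> continuous_on UNIV (clamp_disc B)"
  unfolding clamp_disc_def by (intro continuous_intros) (auto simp: max_def)

text \<open>
  A measurable function is an almost everywhere limit of continuous functions. Clamping their
  values to the disc of radius B and multiplying them by a continuous cutoff makes dominated
  convergence applicable without changing the limit.
\<close>

lemma continuous_approximation_of_bounded:
  assumes [measurable]: "f \<in> borel_measurable borel" and "0 < B"
    and fB: "\<And>x. cmod (f x) \<le> B" and supp: "\<And>x. B < \<bar>x\<bar> \<Longrightarrow> f x = 0" and "0 < e"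
  shows "\<exists>g. continuous_on UNIV g \<and> (\<forall>x. cmod (g x) \<le> B) \<and> (\<forall>x. B + 1 < \<bar>x\<bar> \<longrightarrow> g x = 0) \<and>
             energy (\<lambda>x. f x - g x) < e"
proof -
  have "f measurable_on UNIV"
    by (subst measurable_on_iff_borel_measurable) (simp_all add: measurable_completion lebesgue_on_UNIV_eq)
  then obtain N g where N: "negligible N" and contg: "\<And>n. continuous_on UNIV (g n)"
    and lim: "\<And>x. x \<notin> N \<Longrightarrow> (\<lambda>n. g n x) \<longlonglongrightarrow> f x"
    unfolding measurable_on_def by auto
  define cut where "cut x = complex_of_real (max 0 (min 1 (B + 1 - \<bar>x\<bar>)))" for x :: real
  define h where "h n x = cut x * clamp_disc B (g n x)" for n x
  have cut1: "cmod (cut x) \<le> 1" for x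
    by (auto simp: cut_def)
  have conth: "continuous_on UNIV (h n)" for n
    unfolding h_def cut_def
    by (intro continuous_intros continuous_on_compose2 [OF continuous_on_clamp_disc [OF \<open>0 < B\<close>] contg]) auto
  have hB: "cmod (h n x) \<le> B" for n x
    using mult_mono [OF cut1 [of x] cmod_clamp_disc_le [OF \<open>0 < B\<close>, of "g n x"]] by (simp add: h_def norm_mult)
  have h0: "h n x = 0" if "B + 1 < \<bar>x\<bar>" for n x
    using that by (auto simp: h_def cut_def max_def)
  have [measurable]: "h n \<in> borel_measurable borel" for n
    by (rule borel_measurable_continuous_onI [OF conth])
  have limh: "(\<lambda>n. h n x) \<longlonglongrightarrow> f x" if "x \<notin> N" for x
  proof -
    have "(\<lambda>n. clamp_disc B (g n x)) \<longlonglongrightarrow> clamp_disc B (f x)"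
      by (rule continuous_on_tendsto_compose [OF continuous_on_clamp_disc [OF \<open>0 < B\<close>] lim [OF that]]) auto
    then have "(\<lambda>n. h n x) \<longlonglongrightarrow> cut x * f x"
      unfolding h_def using fB \<open>0 < B\<close> by (intro tendsto_intros) (simp add: clamp_disc_id)
    moreover have "cut x * f x = f x"
    proof (cases "B < \<bar>x\<bar>")
      case False
      then have "min 1 (B + 1 - \<bar>x\<bar>) = 1" by auto
      then show ?thesis by (simp add: cut_def)
    qed (simp add: supp)
    ultimately show ?thesis by simp
  qed
  have "AE x in lebesgue. x \<notin> N"
    using N by (simp add: AE_not_in negligible_iff_null_sets)
  then have AE: "AE x in lborel. x \<notin> N"
    by (simp add: AE_completion_iff)
  have "(\<lambda>n. energy (\<lambda>x. f x - h n x)) \<longlonglongrightarrow> (\<integral>x. 0 \<partial>(lborel :: real measure))"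
    unfolding energy_def
  proof (rule integral_dominated_convergence)
    show "integrable lborel (\<lambda>x::real. (2 * B)\<^sup>2 * indicator {-(B+1)..B+1} x)"
      by (intro integrable_mult_right integrable_real_indicator) (auto simp: emeasure_lborel_Icc_eq)
    show "AE x in lborel. (\<lambda>n. (cmod (f x - h n x))\<^sup>2) \<longlonglongrightarrow> 0"
      using AE
    proof eventually_elim
      case (elim x)
      have "(\<lambda>n. (cmod (f x - h n x))\<^sup>2) \<longlonglongrightarrow> (cmod (f x - f x))\<^sup>2"
        by (intro tendsto_intros limh elim)
      then show ?case by simp
    qed
    show "AE x in lborel. norm ((cmod (f x - h n x))\<^sup>2) \<le> (2 * B)\<^sup>2 * indicator {-(B+1)..B+1} x" for n
    proof (rule AE_I2)
      fix x
      have "cmod (f x - h n x) \<le> 2 * B"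
        using norm_triangle_ineq4 [of "f x" "h n x"] fB [of x] hB [of n x] by linarith
      then have "(cmod (f x - h n x))\<^sup>2 \<le> (2 * B)\<^sup>2"
        by (intro power_mono) auto
      moreover have "f x - h n x = 0" if "x \<notin> {-(B+1)..B+1}"
        using that \<open>0 < B\<close> h0 [of x n] supp [of x] by force
      ultimately show "norm ((cmod (f x - h n x))\<^sup>2) \<le> (2 * B)\<^sup>2 * indicator {-(B+1)..B+1} x"
        by (auto simp: indicator_def)
    qed
  qed measurable
  then have "\<forall>\<^sub>F n in sequentially. energy (\<lambda>x. f x - h n x) < e"
    using \<open>0 < e\<close> by (intro order_tendstoD) simp_all
  then obtain n where "energy (\<lambda>x. f x - h n x) < e"
    by (auto simp: eventually_sequentially)
  with conth hB h0 show ?thesis by blast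
qed

lemma bounded_approximation:
  assumes f: "square_integrable f" and "0 < e"
  shows "\<exists>g B. g \<in> borel_measurable borel \<and> 0 < B \<and> (\<forall>x. cmod (g x) \<le> B) \<and>
               (\<forall>x. B < \<bar>x\<bar> \<longrightarrow> g x = 0) \<and> energy (\<lambda>x. f x - g x) < e"
proof -
  note [measurable] = square_integrable_measurable [OF f]
  define g where "g n x = (if \<bar>x\<bar> \<le> real n \<and> cmod (f x) \<le> real n then f x else 0)" for n x
  have [measurable]: "g n \<in> borel_measurable borel" for n
    unfolding g_def by measurable
  have "(\<lambda>n. energy (\<lambda>x. f x - g n x)) \<longlonglongrightarrow> (\<integral>x. 0 \<partial>(lborel :: real measure))"
    unfolding energy_def
  proof (rule integral_dominated_convergence)
    show "integrable lborel (\<lambda>x. (cmod (f x))\<^sup>2)"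
      using f by (simp add: square_integrable_def)
    show "AE x in lborel. (\<lambda>n. (cmod (f x - g n x))\<^sup>2) \<longlonglongrightarrow> 0"
    proof (rule AE_I2)
      fix x
      obtain m where m: "max \<bar>x\<bar> (cmod (f x)) \<le> real m"
        using real_arch_simple by blast
      have "\<forall>\<^sub>F n in sequentially. (cmod (f x - g n x))\<^sup>2 = 0"
        using eventually_ge_at_top [of m]
      proof eventually_elim
        case (elim n)
        then have "real m \<le> real n" by simp
        then show ?case using m by (simp add: g_def)
      qed
      then show "(\<lambda>n. (cmod (f x - g n x))\<^sup>2) \<longlonglongrightarrow> 0"
        by (rule tendsto_eventually)
    qed
  qed (auto simp: g_def)
  then have "\<forall>\<^sub>F n in sequentially. energy (\<lambda>x. f x - g n x) < e"
    using \<open>0 < e\<close> by (intro order_tendstoD) simp_all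
  with eventually_gt_at_top [of "0::nat"]
  have "\<forall>\<^sub>F n in sequentially. 0 < n \<and> energy (\<lambda>x. f x - g n x) < e"
    by (rule eventually_conj)
  then obtain n where "0 < n" "energy (\<lambda>x. f x - g n x) < e"
    by (auto simp: eventually_sequentially)
  then show ?thesis
    by (intro exI [of _ "g n"] exI [of _ "real n"]) (auto simp: g_def)
qed

lemma translation_continuous_bounded:
  assumes cont: "continuous_on UNIV g" and gB: "\<And>x. cmod (g x) \<le> B"
    and supp: "\<And>x. B < \<bar>x\<bar> \<Longrightarrow> g x = 0" and X: "X \<longlonglongrightarrow> 0"
  shows "(\<lambda>n. energy (\<lambda>x. g (x + X n) - g x)) \<longlonglongrightarrow> 0"
proof -
  have [measurable]: "g \<in> borel_measurable borel"
    by (rule borel_measurable_continuous_onI [OF cont])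
  have "Bseq X" using X by (intro convergent_imp_Bseq convergentI)
  then obtain K where K: "\<And>n. \<bar>X n\<bar> \<le> K"
    by (auto simp: Bseq_def)
  have "(\<lambda>n. energy (\<lambda>x. g (x + X n) - g x)) \<longlonglongrightarrow> (\<integral>x. 0 \<partial>(lborel :: real measure))"
    unfolding energy_def
  proof (rule integral_dominated_convergence)
    show "integrable lborel (\<lambda>x::real. (2 * B)\<^sup>2 * indicator {-(B+K)..B+K} x)"
      by (intro integrable_mult_right integrable_real_indicator) (auto simp: emeasure_lborel_Icc_eq)
    show "AE x in lborel. (\<lambda>n. (cmod (g (x + X n) - g x))\<^sup>2) \<longlonglongrightarrow> 0"
    proof (rule AE_I2)
      fix x
      have "(\<lambda>n. x + X n) \<longlonglongrightarrow> x"
        using tendsto_add [OF tendsto_const X] by simp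
      then have "(\<lambda>n. g (x + X n)) \<longlonglongrightarrow> g x"
        by (intro continuous_on_tendsto_compose [OF cont]) auto
      then have "(\<lambda>n. (cmod (g (x + X n) - g x))\<^sup>2) \<longlonglongrightarrow> (cmod (g x - g x))\<^sup>2"
        by (intro tendsto_intros)
      then show "(\<lambda>n. (cmod (g (x + X n) - g x))\<^sup>2) \<longlonglongrightarrow> 0" by simp
    qed
    show "AE x in lborel. norm ((cmod (g (x + X n) - g x))\<^sup>2) \<le> (2 * B)\<^sup>2 * indicator {-(B+K)..B+K} x" for n
    proof (rule AE_I2)
      fix x
      have "cmod (g (x + X n) - g x) \<le> 2 * B"
        using norm_triangle_ineq4 [of "g (x + X n)" "g x"] gB [of x] gB [of "x + X n"] by linarith
      then have "(cmod (g (x + X n) - g x))\<^sup>2 \<le> (2 * B)\<^sup>2"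
        by (intro power_mono) auto
      moreover have "g (x + X n) - g x = 0" if "x \<notin> {-(B+K)..B+K}"
        using that K [of n] supp [of x] supp [of "x + X n"] by force
      ultimately show "norm ((cmod (g (x + X n) - g x))\<^sup>2) \<le> (2 * B)\<^sup>2 * indicator {-(B+K)..B+K} x"
        by (auto simp: indicator_def)
    qed
  qed measurable
  then show ?thesis by simp
qed

text \<open>
  The claim is dominated convergence for continuous functions of bounded support; these are dense,
  and translations preserve the energy.
\<close>

lemma translation_continuous_L2:
  assumes f: "square_integrable f" and X: "X \<longlonglongrightarrow> 0"
  shows "(\<lambda>n. energy (\<lambda>x. f (x + X n) - f x)) \<longlonglongrightarrow> 0"
proof (rule LIMSEQ_I)
  fix e :: real assume "0 < e"
  \<comment> \<open>Two successive approximations cost a factor 4, and splitting the increment of f into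
      three parts costs another factor 8.\<close>
  then have e: "0 < e / 48" by simp
  obtain h B where h: "h \<in> borel_measurable borel" "0 < B" "\<And>x. cmod (h x) \<le> B"
      "\<And>x. B < \<bar>x\<bar> \<Longrightarrow> h x = 0" and fh: "energy (\<lambda>x. f x - h x) < e / 48"
    using bounded_approximation [OF f e] by blast
  obtain g where contg: "continuous_on UNIV g" and gB: "\<And>x. cmod (g x) \<le> B"
    and g0: "\<And>x. B + 1 < \<bar>x\<bar> \<Longrightarrow> g x = 0" and hg: "energy (\<lambda>x. h x - g x) < e / 48"
    using continuous_approximation_of_bounded [OF h e] by blast
  have bdd: "square_integrable k"
    if "k \<in> borel_measurable borel" "\<And>x. cmod (k x) \<le> B" "\<And>x. B + 1 < \<bar>x\<bar> \<Longrightarrow> k x = 0" for k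
  proof (rule square_integrable_dominated)
    show "integrable lborel (\<lambda>x::real. B\<^sup>2 * indicator {-(B+1)..B+1} x)"
      by (intro integrable_mult_right integrable_real_indicator) (auto simp: emeasure_lborel_Icc_eq)
    show "(cmod (k x))\<^sup>2 \<le> B\<^sup>2 * indicator {-(B+1)..B+1} x" for x
      using power_mono [OF that(2), of x 2] that(3) [of x] by (cases "B + 1 < \<bar>x\<bar>") (auto simp: indicator_def)
  qed (fact that)
  have sh: "square_integrable h"
    using h by (intro bdd) auto
  have sg: "square_integrable g"
    using gB g0 by (intro bdd borel_measurable_continuous_onI [OF contg])
  have fg: "energy (\<lambda>x. f x - g x) < e / 12"
    using energy_add_le [OF square_integrable_diff [OF f sh] square_integrable_diff [OF sh sg]] fh hg by simp
  have sfg: "square_integrable (\<lambda>x. f x - g x)"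
    by (rule square_integrable_diff [OF f sg])
  have gB': "cmod (g x) \<le> B + 1" for x
    using gB [of x] by simp
  have "(\<lambda>n. energy (\<lambda>x. g (x + X n) - g x)) \<longlonglongrightarrow> 0"
    by (rule translation_continuous_bounded [OF contg gB' g0 X])
  then have "\<forall>\<^sub>F n in sequentially. energy (\<lambda>x. g (x + X n) - g x) < e / 48"
    using e by (rule order_tendstoD)
  then obtain M where M: "\<And>n. M \<le> n \<Longrightarrow> energy (\<lambda>x. g (x + X n) - g x) < e / 48"
    by (auto simp: eventually_sequentially)
  have "norm (energy (\<lambda>x. f (x + X n) - f x) - 0) < e" if "M \<le> n" for n
  proof -
    let ?a = "\<lambda>x. (f (x + X n) - g (x + X n))" and ?b = "\<lambda>x. g x - f x" and ?c = "\<lambda>x. g (x + X n) - g x"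
    have sb: "square_integrable ?b" and sc: "square_integrable ?c"
      by (intro square_integrable_diff square_integrable_translate sg f)+
    have sa: "square_integrable ?a"
      by (rule square_integrable_translate [OF sfg])
    have "energy (\<lambda>x. f (x + X n) - f x) = energy (\<lambda>x. (?a x + ?b x) + ?c x)"
      by (simp add: algebra_simps)
    also have "\<dots> \<le> 2 * energy (\<lambda>x. ?a x + ?b x) + 2 * energy ?c"
      by (intro energy_add_le square_integrable_add sa sb sc)
    also have "energy (\<lambda>x. ?a x + ?b x) \<le> 2 * energy ?a + 2 * energy ?b"
      by (intro energy_add_le sa sb)
    also have "energy ?a = energy (\<lambda>x. f x - g x)"
      by (rule energy_translate [of "\<lambda>x. f x - g x"])
    also have "energy ?b = energy (\<lambda>x. f x - g x)"
      by (rule energy_minus_commute)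
    finally have "energy (\<lambda>x. f (x + X n) - f x) \<le>
        2 * (2 * energy (\<lambda>x. f x - g x) + 2 * energy (\<lambda>x. f x - g x)) + 2 * energy ?c" by simp
    moreover have "2 * (2 * a + 2 * a) + 2 * b < e" if "a < e / 12" "b < e / 48" for a b
      using that \<open>0 < e\<close> by argo
    ultimately have "energy (\<lambda>x. f (x + X n) - f x) < e"
      using fg M [OF that] by (meson order_le_less_trans)
    then show ?thesis by simp
  qed
  then show "\<exists>M. \<forall>n\<ge>M. norm (energy (\<lambda>x. f (x + X n) - f x) - 0) < e" by blast
qed

section \<open>Plancherel's identity for integrable functions\<close>

definition fourier_integral :: "(real \<Rightarrow> complex) \<Rightarrow> real \<Rightarrow> complex" where
  "fourier_integral F \<xi> = (\<integral>x. exp (- (\<i> * complex_of_real (x * \<xi>))) * F x \<partial>lborel)"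

lemma cmod_exp_minus_i [simp]: "cmod (exp (- (\<i> * complex_of_real t))) = 1"
  by (simp add: norm_exp_eq_Re)

lemma borel_measurable_cnj [measurable]:
  "f \<in> borel_measurable M \<Longrightarrow> (\<lambda>x. cnj (f x)) \<in> borel_measurable M"
  by (rule borel_measurable_continuous_on [of cnj]) (intro continuous_intros)+

lemma borel_measurable_fourier_integral [measurable]:
  assumes [measurable]: "F \<in> borel_measurable borel"
  shows "fourier_integral F \<in> borel_measurable borel"
  unfolding fourier_integral_def by measurable

lemma integrable_character_mult:
  assumes "integrable lborel F"
  shows "integrable lborel (\<lambda>x. exp (- (\<i> * complex_of_real (x * \<xi>))) * F x)"
  by (rule Bochner_Integration.integrable_bound [OF assms])
     (use borel_measurable_integrable [OF assms] in \<open>simp_all add: norm_mult\<close>)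

lemma cmod_fourier_integral_le:
  "cmod (fourier_integral F \<xi>) \<le> (\<integral>x. cmod (F x) \<partial>lborel)"
  unfolding fourier_integral_def
  by (rule order_trans [OF integral_norm_bound]) (simp add: norm_mult)

definition autocorrelation :: "(real \<Rightarrow> complex) \<Rightarrow> real \<Rightarrow> complex" where
  "autocorrelation F t = (\<integral>x. F x * cnj (F (x + t)) \<partial>lborel)"

text \<open>
  The squared modulus of a Fourier transform is the transform of the autocorrelation. The
  substitution z = x + e * s in the conjugate factor makes the frequency y / e appear as the character
  exp (\<i> s y), so that e survives only inside F. The limit of small e will then be a limit of
  translations.
\<close>

lemma fourier_integral_times_cnj:
  assumes F: "integrable lborel F" and "0 < e"
  shows "fourier_integral F (y / e) * cnj (fourier_integral F (y / e)) =
    e * (\<integral>x. \<integral>s. exp (\<i> * complex_of_real (s * y)) * (F x * cnj (F (x + e * s))) \<partial>lborel \<partial>lborel)"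
proof -
  let ?\<xi> = "y / e"
  \<comment> \<open>The substitution may be made with any x; below, x is the variable of the outer integral.\<close>
  have "cnj (fourier_integral F ?\<xi>) = (\<integral>z. cnj (exp (- (\<i> * complex_of_real (z * ?\<xi>))) * F z) \<partial>lborel)"
    unfolding fourier_integral_def by (rule Bochner_Integration.integral_cnj [symmetric])
  also have "\<dots> = (\<integral>z. exp (\<i> * complex_of_real (z * ?\<xi>)) * cnj (F z) \<partial>lborel)"
    by (rule Bochner_Integration.integral_cong) (simp_all add: exp_cnj)
  also have "\<dots> = e * (\<integral>s. exp (\<i> * complex_of_real ((x + e * s) * ?\<xi>)) * cnj (F (x + e * s)) \<partial>lborel)" for x
    using \<open>0 < e\<close> by (subst lborel_integral_real_affine [of e _ x]) (simp_all add: scaleR_conv_of_real)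
  finally have cn: "cnj (fourier_integral F ?\<xi>) =
      e * (\<integral>s. exp (\<i> * complex_of_real ((x + e * s) * ?\<xi>)) * cnj (F (x + e * s)) \<partial>lborel)" for x .
  have "fourier_integral F ?\<xi> * cnj (fourier_integral F ?\<xi>) =
      (\<integral>x. exp (- (\<i> * complex_of_real (x * ?\<xi>))) * F x * cnj (fourier_integral F ?\<xi>) \<partial>lborel)"
    unfolding fourier_integral_def [of F] by simp
  also have "\<dots> = (\<integral>x. e * (\<integral>s. exp (\<i> * complex_of_real (s * y)) * (F x * cnj (F (x + e * s))) \<partial>lborel) \<partial>lborel)"
  proof (rule Bochner_Integration.integral_cong [OF refl])
    fix x
    have "exp (- (\<i> * complex_of_real (x * ?\<xi>))) * F x * cnj (fourier_integral F ?\<xi>) =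
       e * (\<integral>s. (exp (- (\<i> * complex_of_real (x * ?\<xi>))) * F x) *
          (exp (\<i> * complex_of_real ((x + e * s) * ?\<xi>)) * cnj (F (x + e * s))) \<partial>lborel)"
      unfolding cn [of x] by simp
    also have "\<dots> = e * (\<integral>s. exp (\<i> * complex_of_real (s * y)) * (F x * cnj (F (x + e * s))) \<partial>lborel)"
    proof -
      have "(exp (- (\<i> * complex_of_real (x * ?\<xi>))) * F x) *
          (exp (\<i> * complex_of_real ((x + e * s) * ?\<xi>)) * cnj (F (x + e * s))) =
          exp (\<i> * complex_of_real (s * y)) * (F x * cnj (F (x + e * s)))" for s
      proof -
        have "exp (- (\<i> * complex_of_real (x * ?\<xi>))) * exp (\<i> * complex_of_real ((x + e * s) * ?\<xi>))
            = exp (\<i> * complex_of_real (s * y))"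
          using \<open>0 < e\<close> by (simp add: exp_add [symmetric] field_simps)
        then show ?thesis by (simp add: mult_ac)
      qed
      then show ?thesis by (simp only:)
    qed
    finally show "exp (- (\<i> * complex_of_real (x * ?\<xi>))) * F x * cnj (fourier_integral F ?\<xi>) =
      e * (\<integral>s. exp (\<i> * complex_of_real (s * y)) * (F x * cnj (F (x + e * s))) \<partial>lborel)" .
  qed
  finally show ?thesis by simp
qed

lemma integrable_correlation_kernel:
  fixes F :: "real \<Rightarrow> complex"
  assumes F: "integrable lborel F" and "0 < e"
  shows "integrable (lborel \<Otimes>\<^sub>M lborel) (\<lambda>(x, s). F x * cnj (F (x + e * s)))"
proof -
  have [measurable]: "F \<in> borel_measurable borel"
    using F by auto
  have int: "integrable lborel (\<lambda>s. F (x + e * s))" for x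
    using \<open>0 < e\<close> lborel_integrable_real_affine [OF F, of e x] by simp
  have eq: "(\<integral>s. cmod (F (x + e * s)) \<partial>lborel) = (\<integral>z. cmod (F z) \<partial>lborel) / e" for x
    using \<open>0 < e\<close> lborel_integral_real_affine [of e "\<lambda>z. cmod (F z)" x] by simp
  show ?thesis
  proof (rule lborel_pair.Fubini_integrable)
    show "integrable lborel (\<lambda>x. \<integral>s. norm (case (x, s) of (x, s) \<Rightarrow> F x * cnj (F (x + e * s))) \<partial>lborel)"
      using F by (simp add: norm_mult eq)
    show "AE x in lborel. integrable lborel (\<lambda>s. case (x, s) of (x, s) \<Rightarrow> F x * cnj (F (x + e * s)))"
      using int by (simp add: integrable_cnj)
  qed measurable
qed

text \<open>
  By Fubini the average over y may be taken first; it turns exp (\<i> s y) into the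
  characteristic function exp (- s^2 / 2) of the normal distribution, which is again a
  multiple of the normal density in s.
\<close>

lemma gaussian_average_of_spectrum:
  assumes F: "integrable lborel F" and "0 < e"
  shows "(\<integral>y. (cmod (fourier_integral F (y / e)))\<^sup>2 \<partial>std_normal_distribution) =
         e * sqrt (2 * pi) * (\<integral>s. Re (autocorrelation F (e * s)) \<partial>std_normal_distribution)"
proof -
  interpret N: real_distribution std_normal_distribution by (rule real_dist_normal_dist)
  interpret P: sigma_finite_measure "lborel \<Otimes>\<^sub>M (lborel :: real measure)"
    by (rule sigma_finite_pair_measure) (rule sigma_finite_lborel)+
  interpret NP: pair_sigma_finite std_normal_distribution "lborel \<Otimes>\<^sub>M (lborel :: real measure)" ..
  have [measurable]: "F \<in> borel_measurable borel"
    using F by auto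
  define H where "H p = F (fst p) * cnj (F (fst p + e * snd p))" for p
  have H [measurable]: "H \<in> borel_measurable (lborel \<Otimes>\<^sub>M lborel)"
    unfolding H_def by measurable
  have iH: "integrable (lborel \<Otimes>\<^sub>M lborel) H"
    using integrable_correlation_kernel [OF assms] unfolding H_def by (simp add: case_prod_unfold)
  have bnd: "integrable (lborel \<Otimes>\<^sub>M lborel) (\<lambda>p. c (snd p) * H p)"
    if [measurable]: "c \<in> borel_measurable borel" and "\<And>s. cmod (c s) \<le> 1" for c
  proof (rule Bochner_Integration.integrable_bound [OF iH])
    show "AE p in lborel \<Otimes>\<^sub>M lborel. norm (c (snd p) * H p) \<le> norm (H p)"
      using that(2) by (auto simp: norm_mult intro!: mult_left_le_one_le)
  qed measurable
  have i3: "integrable (std_normal_distribution \<Otimes>\<^sub>M (lborel \<Otimes>\<^sub>M lborel))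
      (\<lambda>(y, p). exp (\<i> * complex_of_real (snd p * y)) * H p)"
  proof (rule NP.Fubini_integrable)
    show "integrable std_normal_distribution
       (\<lambda>y. \<integral>p. norm (case (y, p) of (y, p) \<Rightarrow> exp (\<i> * complex_of_real (snd p * y)) * H p) \<partial>(lborel \<Otimes>\<^sub>M lborel))"
      by (simp add: norm_mult)
    show "AE y in std_normal_distribution. integrable (lborel \<Otimes>\<^sub>M lborel)
       (\<lambda>p. case (y, p) of (y, p) \<Rightarrow> exp (\<i> * complex_of_real (snd p * y)) * H p)"
      using bnd [of "\<lambda>s. exp (\<i> * complex_of_real (s * y))" for y] by simp
  qed measurable
  have char: "(\<integral>y. exp (\<i> * complex_of_real (s * y)) \<partial>std_normal_distribution) = exp (- s\<^sup>2 / 2)" for s :: real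
    using fun_cong [OF char_std_normal_distribution, of s] by (simp add: char_def)
  have "complex_of_real (\<integral>y. (cmod (fourier_integral F (y / e)))\<^sup>2 \<partial>std_normal_distribution) =
      (\<integral>y. complex_of_real ((cmod (fourier_integral F (y / e)))\<^sup>2) \<partial>std_normal_distribution)"
    by (rule integral_complex_of_real [symmetric])
  also have "\<dots> = (\<integral>y. e * (\<integral>p. exp (\<i> * complex_of_real (snd p * y)) * H p \<partial>(lborel \<Otimes>\<^sub>M lborel)) \<partial>std_normal_distribution)"
  proof (rule Bochner_Integration.integral_cong [OF refl])
    fix y
    have "complex_of_real ((cmod (fourier_integral F (y / e)))\<^sup>2) =
        e * (\<integral>x. \<integral>s. exp (\<i> * complex_of_real (s * y)) * (F x * cnj (F (x + e * s))) \<partial>lborel \<partial>lborel)"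
      unfolding complex_norm_square by (rule fourier_integral_times_cnj [OF assms])
    also have "\<dots> = e * (\<integral>p. exp (\<i> * complex_of_real (snd p * y)) * H p \<partial>(lborel \<Otimes>\<^sub>M lborel))"
      by (subst lborel_pair.integral_fst' [symmetric]) (use bnd [of "\<lambda>s. exp (\<i> * complex_of_real (s * y))"] in \<open>simp_all add: H_def\<close>)
    finally show "complex_of_real ((cmod (fourier_integral F (y / e)))\<^sup>2) =
      e * (\<integral>p. exp (\<i> * complex_of_real (snd p * y)) * H p \<partial>(lborel \<Otimes>\<^sub>M lborel))" .
  qed
  also have "\<dots> = e * (\<integral>y. (\<integral>p. exp (\<i> * complex_of_real (snd p * y)) * H p \<partial>(lborel \<Otimes>\<^sub>M lborel)) \<partial>std_normal_distribution)"
    by simp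
  also have "(\<integral>y. (\<integral>p. exp (\<i> * complex_of_real (snd p * y)) * H p \<partial>(lborel \<Otimes>\<^sub>M lborel)) \<partial>std_normal_distribution) =
      (\<integral>p. (\<integral>y. exp (\<i> * complex_of_real (snd p * y)) * H p \<partial>std_normal_distribution) \<partial>(lborel \<Otimes>\<^sub>M lborel))"
    by (rule NP.Fubini_integral [OF i3, symmetric])
  also have "\<dots> = (\<integral>p. complex_of_real (exp (- (snd p)\<^sup>2 / 2)) * H p \<partial>(lborel \<Otimes>\<^sub>M lborel))"
    using char by simp
  also have "\<dots> = (\<integral>s. \<integral>x. complex_of_real (exp (- s\<^sup>2 / 2)) * H (x, s) \<partial>lborel \<partial>lborel)"
    using lborel_pair.integral_snd [of "\<lambda>x s. complex_of_real (exp (- s\<^sup>2 / 2)) * H (x, s)"]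
      bnd [of "\<lambda>s. complex_of_real (exp (- s\<^sup>2 / 2))"] by (simp add: case_prod_unfold)
  also have "\<dots> = (\<integral>s. complex_of_real (exp (- s\<^sup>2 / 2)) * autocorrelation F (e * s) \<partial>lborel)"
    by (simp add: H_def autocorrelation_def)
  also have "\<dots> = (\<integral>s. complex_of_real (sqrt (2 * pi)) * (std_normal_density s *\<^sub>R autocorrelation F (e * s)) \<partial>lborel)"
    by (rule Bochner_Integration.integral_cong)
       (simp_all add: std_normal_density_def scaleR_conv_of_real)
  also have "\<dots> = complex_of_real (sqrt (2 * pi)) * (\<integral>s. autocorrelation F (e * s) \<partial>std_normal_distribution)"
    unfolding integral_mult_right_zero
    by (subst integral_density) (simp_all add: autocorrelation_def)
  finally have *: "complex_of_real (\<integral>y. (cmod (fourier_integral F (y / e)))\<^sup>2 \<partial>std_normal_distribution) =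
    e * (complex_of_real (sqrt (2 * pi)) * (\<integral>s. autocorrelation F (e * s) \<partial>std_normal_distribution))" .
  have "integrable lborel (\<lambda>s. \<integral>x. H (x, s) \<partial>lborel)"
    using lborel_pair.integrable_snd [of "\<lambda>x s. H (x, s)"] iH by simp
  then have "integrable lborel (\<lambda>s. autocorrelation F (e * s))"
    by (simp add: H_def autocorrelation_def)
  then have "integrable lborel (\<lambda>s. std_normal_density s *\<^sub>R autocorrelation F (e * s))"
  proof (rule Bochner_Integration.integrable_bound)
    have "std_normal_density s \<le> 1" for s
      using mult_mono [of "1 / sqrt (2 * pi)" 1 "exp (- s\<^sup>2 / 2)" 1] pi_gt3
      by (simp add: std_normal_density_def real_le_rsqrt)
    then show "AE s in lborel. norm (std_normal_density s *\<^sub>R autocorrelation F (e * s)) \<le> norm (autocorrelation F (e * s))"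
      by (auto intro!: mult_left_le_one_le)
  qed (simp add: autocorrelation_def)
  then have "integrable std_normal_distribution (\<lambda>s. autocorrelation F (e * s))"
    by (subst integrable_density) (simp_all add: autocorrelation_def)
  then have "(\<integral>s. Re (autocorrelation F (e * s)) \<partial>std_normal_distribution) =
      Re (\<integral>s. autocorrelation F (e * s) \<partial>std_normal_distribution)"
    by simp
  with arg_cong [OF *, of Re] show ?thesis by simp
qed

lemma integrable_mult_cnj:
  assumes f: "square_integrable f" and g: "square_integrable g"
  shows "integrable lborel (\<lambda>x. f x * cnj (g x))"
proof (rule Bochner_Integration.integrable_bound)
  show "integrable lborel (\<lambda>x. (cmod (f x))\<^sup>2 + (cmod (g x))\<^sup>2)"
    using assms by (simp add: square_integrable_def)
  have "cmod (f x) * cmod (g x) \<le> (cmod (f x))\<^sup>2 + (cmod (g x))\<^sup>2" for x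
    using sum_squares_bound [of "cmod (f x)" "cmod (g x)"] zero_le_power2 [of "cmod (f x)"] zero_le_power2 [of "cmod (g x)"]
      mult_nonneg_nonneg [of "cmod (f x)" "cmod (g x)"]
    by (simp only: norm_ge_zero)
  then show "AE x in lborel. norm (f x * cnj (g x)) \<le> norm ((cmod (f x))\<^sup>2 + (cmod (g x))\<^sup>2)"
    by (simp add: norm_mult)
qed (use f g in measurable)

text \<open>
  This is the polarisation identity for F and its translate. It reduces continuity of the
  autocorrelation at 0 to continuity of translations.
\<close>

lemma Re_autocorrelation:
  assumes F: "square_integrable F"
  shows "Re (autocorrelation F t) = energy F - energy (\<lambda>x. F (x + t) - F x) / 2"
proof -
  have tr: "square_integrable (\<lambda>x. F (x + t))"
    by (rule square_integrable_translate [OF F])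
  have df: "square_integrable (\<lambda>x. F (x + t) - F x)"
    by (rule square_integrable_diff [OF tr F])
  have polar: "Re (z * cnj w) = ((cmod z)\<^sup>2 + (cmod w)\<^sup>2 - (cmod (w - z))\<^sup>2) / 2" for z w
    by (simp add: cmod_power2) (simp add: power2_eq_square algebra_simps)
  have "Re (autocorrelation F t) = (\<integral>x. Re (F x * cnj (F (x + t))) \<partial>lborel)"
    unfolding autocorrelation_def using integrable_mult_cnj [OF F tr] by (rule integral_Re [symmetric])
  also have "\<dots> = (\<integral>x. ((cmod (F x))\<^sup>2 + (cmod (F (x + t)))\<^sup>2 - (cmod (F (x + t) - F x))\<^sup>2) / 2 \<partial>lborel)"
    unfolding polar ..
  also have "\<dots> = (energy F + energy (\<lambda>x. F (x + t)) - energy (\<lambda>x. F (x + t) - F x)) / 2"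
    using F tr df by (simp add: square_integrable_def energy_def)
  finally show ?thesis
    by (simp add: energy_translate)
qed

text \<open>
  This is gaussian_average_of_spectrum in the frequency variable \<xi> = y / e, in which the transform no
  longer depends on e and the limit of small e can be taken.
\<close>

lemma gaussian_damped_spectrum:
  assumes F: "integrable lborel F" and "0 < e"
  shows "integrable lborel (\<lambda>\<xi>. exp (- (e * \<xi>)\<^sup>2 / 2) * (cmod (fourier_integral F \<xi>))\<^sup>2)"
    and "(\<integral>\<xi>. exp (- (e * \<xi>)\<^sup>2 / 2) * (cmod (fourier_integral F \<xi>))\<^sup>2 \<partial>lborel) =
         2 * pi * (\<integral>s. Re (autocorrelation F (e * s)) \<partial>std_normal_distribution)"
proof -
  interpret N: real_distribution std_normal_distribution by (rule real_dist_normal_dist)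
  have [measurable]: "F \<in> borel_measurable borel"
    using F by auto
  let ?h = "\<lambda>y. std_normal_density y * (cmod (fourier_integral F (y / e)))\<^sup>2"
  have "integrable std_normal_distribution (\<lambda>y. (cmod (fourier_integral F (y / e)))\<^sup>2)"
  proof (rule N.integrable_const_bound)
    show "AE y in std_normal_distribution. norm ((cmod (fourier_integral F (y / e)))\<^sup>2) \<le> (\<integral>x. cmod (F x) \<partial>lborel)\<^sup>2"
      by (simp add: power_mono cmod_fourier_integral_le)
  qed measurable
  then have i: "integrable lborel ?h"
    by (subst (asm) integrable_density) simp_all
  have h: "?h (0 + e * \<xi>) = (1 / sqrt (2 * pi)) * (exp (- (e * \<xi>)\<^sup>2 / 2) * (cmod (fourier_integral F \<xi>))\<^sup>2)" for \<xi>
    using \<open>0 < e\<close> by (simp add: std_normal_density_def)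
  have "integrable lborel (\<lambda>\<xi>. ?h (0 + e * \<xi>))"
    using \<open>0 < e\<close> by (intro lborel_integrable_real_affine [OF i]) simp
  then have "integrable lborel (\<lambda>\<xi>. sqrt (2 * pi) * ((1 / sqrt (2 * pi)) * (exp (- (e * \<xi>)\<^sup>2 / 2) * (cmod (fourier_integral F \<xi>))\<^sup>2)))"
    unfolding h by (rule integrable_mult_right)
  then show "integrable lborel (\<lambda>\<xi>. exp (- (e * \<xi>)\<^sup>2 / 2) * (cmod (fourier_integral F \<xi>))\<^sup>2)"
    by simp
  have "e * sqrt (2 * pi) * (\<integral>s. Re (autocorrelation F (e * s)) \<partial>std_normal_distribution) = integral\<^sup>L lborel ?h"
    unfolding gaussian_average_of_spectrum [OF assms, symmetric]
    by (subst integral_density) simp_all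
  also have "\<dots> = e * (\<integral>\<xi>. ?h (0 + e * \<xi>) \<partial>lborel)"
    using \<open>0 < e\<close> by (subst lborel_integral_real_affine [of e _ 0]) simp_all
  also have "\<dots> = e * ((1 / sqrt (2 * pi)) * (\<integral>\<xi>. exp (- (e * \<xi>)\<^sup>2 / 2) * (cmod (fourier_integral F \<xi>))\<^sup>2 \<partial>lborel))"
    unfolding h by simp
  finally have "e * (sqrt (2 * pi) * (\<integral>s. Re (autocorrelation F (e * s)) \<partial>std_normal_distribution)) =
      e * ((1 / sqrt (2 * pi)) * (\<integral>\<xi>. exp (- (e * \<xi>)\<^sup>2 / 2) * (cmod (fourier_integral F \<xi>))\<^sup>2 \<partial>lborel))"
    by (simp only: mult.assoc)
  moreover have "e \<noteq> 0" using \<open>0 < e\<close> by simp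
  ultimately have *: "sqrt (2 * pi) * (\<integral>s. Re (autocorrelation F (e * s)) \<partial>std_normal_distribution) =
      (1 / sqrt (2 * pi)) * (\<integral>\<xi>. exp (- (e * \<xi>)\<^sup>2 / 2) * (cmod (fourier_integral F \<xi>))\<^sup>2 \<partial>lborel)"
    using mult_left_cancel by blast
  show "(\<integral>\<xi>. exp (- (e * \<xi>)\<^sup>2 / 2) * (cmod (fourier_integral F \<xi>))\<^sup>2 \<partial>lborel) =
         2 * pi * (\<integral>s. Re (autocorrelation F (e * s)) \<partial>std_normal_distribution)"
  proof -
    have "J = 2 * pi * a" if "sqrt (2 * pi) * a = (1 / sqrt (2 * pi)) * J" for a J
    proof -
      have "2 * pi * a = sqrt (2 * pi) * (sqrt (2 * pi) * a)"
        by (simp flip: mult.assoc)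
      also have "\<dots> = J"
        unfolding that by simp
      finally show ?thesis ..
    qed
    then show ?thesis using * by blast
  qed
qed

lemma autocorrelation_average_tendsto:
  assumes F: "square_integrable F" and X: "X \<longlonglongrightarrow> 0"
  shows "(\<lambda>n. \<integral>s. Re (autocorrelation F (X n * s)) \<partial>std_normal_distribution) \<longlonglongrightarrow> energy F"
proof -
  interpret N: real_distribution std_normal_distribution by (rule real_dist_normal_dist)
  note [measurable] = square_integrable_measurable [OF F]
  have "(\<lambda>n. \<integral>s. Re (autocorrelation F (X n * s)) \<partial>std_normal_distribution) \<longlonglongrightarrow>
     (\<integral>s. energy F \<partial>std_normal_distribution)"
  proof (rule integral_dominated_convergence)
    show "integrable std_normal_distribution (\<lambda>s. energy F)"
      by simp
    show "AE s in std_normal_distribution. (\<lambda>n. Re (autocorrelation F (X n * s))) \<longlonglongrightarrow> energy F"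
    proof (rule AE_I2)
      fix s
      have "(\<lambda>n. X n * s) \<longlonglongrightarrow> 0"
        using tendsto_mult_right [OF X, of s] by simp
      from translation_continuous_L2 [OF F this]
      have "(\<lambda>n. energy F - energy (\<lambda>x. F (x + X n * s) - F x) / 2) \<longlonglongrightarrow> energy F - 0 / 2"
        by (intro tendsto_intros) simp_all
      then show "(\<lambda>n. Re (autocorrelation F (X n * s))) \<longlonglongrightarrow> energy F"
        by (simp add: Re_autocorrelation [OF F])
    qed
    show "AE s in std_normal_distribution. norm (Re (autocorrelation F (X n * s))) \<le> energy F" for n
    proof (rule AE_I2)
      fix s
      let ?t = "X n * s"
      have "energy (\<lambda>x. F (x + ?t) - F x) \<le> 2 * energy (\<lambda>x. F (x + ?t)) + 2 * energy (\<lambda>x. - F x)"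
        using energy_add_le [OF square_integrable_translate [OF F, of ?t] square_integrable_cmult [OF F, of "-1"]] by simp
      also have "\<dots> = 4 * energy F"
        by (simp add: energy_translate energy_def [of "\<lambda>x. - F x"] flip: energy_def)
      finally show "norm (Re (autocorrelation F (X n * s))) \<le> energy F"
        using energy_nonneg [of "\<lambda>x. F (x + ?t) - F x"]
        by (simp add: Re_autocorrelation [OF F] abs_le_iff)
    qed
  qed (simp_all add: autocorrelation_def)
  then show ?thesis
    using N.prob_space by simp
qed

text \<open>
  The damping factors increase to 1, so the left sides of gaussian_damped_spectrum converge by
  monotone convergence, while the right sides converge by autocorrelation_average_tendsto. The
  convergence of the right sides also gives the integrability of the squared transform.
\<close>

lemma plancherel_integrable:
  assumes F: "integrable lborel F" and F2: "square_integrable F"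
  shows "square_integrable (\<lambda>\<xi>. fourier_integral F \<xi> / sqrt (2 * pi))"
    and "energy (\<lambda>\<xi>. fourier_integral F \<xi> / sqrt (2 * pi)) = energy F"
proof -
  note [measurable] = square_integrable_measurable [OF F2]
  define X where "X n = inverse (real (Suc n))" for n
  have X: "X \<longlonglongrightarrow> 0" and Xpos: "\<And>n. 0 < X n" and Xmono: "\<And>m n. m \<le> n \<Longrightarrow> X n \<le> X m"
    unfolding X_def by (rule LIMSEQ_inverse_real_of_nat) (auto simp: le_imp_inverse_le)
  let ?f = "\<lambda>n \<xi>. exp (- (X n * \<xi>)\<^sup>2 / 2) * (cmod (fourier_integral F \<xi>))\<^sup>2"
  have mono: "mono (\<lambda>n. ?f n \<xi>)" for \<xi>
  proof (rule monoI)
    fix m n :: nat assume "m \<le> n"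
    then have "\<bar>X n * \<xi>\<bar> \<le> \<bar>X m * \<xi>\<bar>"
      using Xmono [of m n] Xpos [of n] by (simp add: abs_mult mult_right_mono)
    then have "(X n * \<xi>)\<^sup>2 \<le> (X m * \<xi>)\<^sup>2"
      by (simp add: abs_le_square_iff)
    then show "?f m \<xi> \<le> ?f n \<xi>"
      by (intro mult_right_mono) auto
  qed
  have lim: "(\<lambda>n. ?f n \<xi>) \<longlonglongrightarrow> (cmod (fourier_integral F \<xi>))\<^sup>2" for \<xi>
  proof -
    have "(\<lambda>n. ?f n \<xi>) \<longlonglongrightarrow> exp (- (0 * \<xi>)\<^sup>2 / 2) * (cmod (fourier_integral F \<xi>))\<^sup>2"
      by (intro tendsto_intros X) simp
    then show ?thesis by simp
  qed
  have ilim: "(\<lambda>n. integral\<^sup>L lborel (?f n)) \<longlonglongrightarrow> 2 * pi * energy F"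
    unfolding gaussian_damped_spectrum(2) [OF F Xpos]
    by (intro tendsto_intros autocorrelation_average_tendsto F2 X)
  have int: "integrable lborel (\<lambda>\<xi>. (cmod (fourier_integral F \<xi>))\<^sup>2)"
    by (rule integrable_monotone_convergence [OF gaussian_damped_spectrum(1) [OF F Xpos] _ _ ilim])
       (use mono lim in auto)
  have eq: "(\<integral>\<xi>. (cmod (fourier_integral F \<xi>))\<^sup>2 \<partial>lborel) = 2 * pi * energy F"
    by (rule integral_monotone_convergence [OF gaussian_damped_spectrum(1) [OF F Xpos] _ _ ilim])
       (use mono lim in auto)
  have sq: "(cmod (fourier_integral F \<xi> / sqrt (2 * pi)))\<^sup>2 = (cmod (fourier_integral F \<xi>))\<^sup>2 / (2 * pi)" for \<xi>
    by (simp add: norm_divide power_divide)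
  show "square_integrable (\<lambda>\<xi>. fourier_integral F \<xi> / sqrt (2 * pi))"
    unfolding square_integrable_def sq using int by simp
  show "energy (\<lambda>\<xi>. fourier_integral F \<xi> / sqrt (2 * pi)) = energy F"
    unfolding energy_def sq using eq by (simp add: energy_def)
qed

section \<open>The Fourier--Plancherel transform\<close>

lemma energy_cmult: "energy (\<lambda>x. c * f x) = (cmod c)\<^sup>2 * energy f"
  by (simp add: energy_def norm_mult power_mult_distrib)

lemma energy_add_polar:
  assumes f: "square_integrable f" and g: "square_integrable g"
  shows "energy (\<lambda>x. f x + z * g x) =
    energy f + (cmod z)\<^sup>2 * energy g + 2 * Re (cnj z * (\<integral>x. f x * cnj (g x) \<partial>lborel))"
proof -
  have pt: "(cmod (a + z * b))\<^sup>2 = (cmod a)\<^sup>2 + (cmod z)\<^sup>2 * (cmod b)\<^sup>2 + 2 * Re (cnj z * (a * cnj b))" for a b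
    unfolding cmod_power2 by (simp add: power2_eq_square algebra_simps)
  have i: "integrable lborel (\<lambda>x. cnj z * (f x * cnj (g x)))"
    by (intro integrable_mult_right integrable_mult_cnj f g)
  define C where "C x = Re (cnj z * (f x * cnj (g x)))" for x
  have "integrable lborel C" and "integral\<^sup>L lborel C = Re (cnj z * (\<integral>x. f x * cnj (g x) \<partial>lborel))"
    unfolding C_def using integrable_Re [OF i] integral_Re [OF i] by simp_all
  then show ?thesis
    unfolding energy_def pt C_def [symmetric] using f g by (simp add: square_integrable_def)
qed

lemma L2_iff_square_integrable:
  "f \<in> borel_measurable borel \<Longrightarrow> f \<in> L2 \<longleftrightarrow> square_integrable f"
  by (simp add: L2_def square_integrable_def integrable_completion measurable_completion)

lemma integrable_window:
  assumes f: "square_integrable f"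
  shows "integrable lborel (\<lambda>x. indicator {-R..R} x * f x)"
proof (rule Bochner_Integration.integrable_bound)
  show "integrable lborel (\<lambda>x. indicator {-R..R} x + (cmod (f x))\<^sup>2)"
    using f by (intro Bochner_Integration.integrable_add integrable_real_indicator)
      (auto simp: square_integrable_def emeasure_lborel_Icc_eq)
  have "cmod (f x) \<le> 1 + (cmod (f x))\<^sup>2" for x
  proof -
    have "2 * cmod (f x) \<le> 1 + (cmod (f x))\<^sup>2"
      using sum_squares_bound [of 1 "cmod (f x)"] by simp
    then show ?thesis
      using norm_ge_zero [of "f x"] by linarith
  qed
  then show "AE x in lborel. norm (indicator {-R..R} x * f x) \<le> norm (indicator {-R..R} x + (cmod (f x))\<^sup>2)"
    by (auto simp: indicator_def)
qed (use f in measurable)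

lemma truncated_fourier_eq:
  assumes [measurable]: "f \<in> borel_measurable borel"
  shows "truncated_fourier R f \<xi> = fourier_integral (\<lambda>x. indicator {-R..R} x * f x) \<xi> / sqrt (2 * pi)"
proof -
  have "(LINT x:{-R..R}|lebesgue. exp (- (\<i> * complex_of_real (x * \<xi>))) * f x) =
      (LINT x|lebesgue. exp (- (\<i> * complex_of_real (x * \<xi>))) * (indicator {-R..R} x * f x))"
    unfolding set_lebesgue_integral_def by (rule Bochner_Integration.integral_cong) (auto simp: indicator_def)
  also have "\<dots> = fourier_integral (\<lambda>x. indicator {-R..R} x * f x) \<xi>"
    unfolding fourier_integral_def by (rule integral_completion) measurable
  finally show ?thesis
    by (simp add: truncated_fourier_def)
qed

lemma truncated_fourier_plancherel:
  assumes f: "square_integrable f"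
  shows "square_integrable (truncated_fourier R f)"
    and "energy (truncated_fourier R f) = energy (\<lambda>x. indicator {-R..R} x * f x)"
proof -
  note [measurable] = square_integrable_measurable [OF f]
  have eq: "truncated_fourier R f = (\<lambda>\<xi>. fourier_integral (\<lambda>x. indicator {-R..R} x * f x) \<xi> / sqrt (2 * pi))"
    by (rule ext) (rule truncated_fourier_eq, measurable)
  have "square_integrable (\<lambda>x. indicator {-R..R} x * f x)"
    by (rule square_integrable_indicator [OF f]) simp
  note * = plancherel_integrable [OF integrable_window [OF f] this]
  show "square_integrable (truncated_fourier R f)" "energy (truncated_fourier R f) = energy (\<lambda>x. indicator {-R..R} x * f x)"
    unfolding eq by (fact *)+
qed

lemma has_fourier_iff:
  assumes "f \<in> borel_measurable borel" and "g \<in> borel_measurable borel"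
  shows "has_fourier f g \<longleftrightarrow> square_integrable f \<and> square_integrable g \<and>
    ((\<lambda>R. energy (\<lambda>\<xi>. truncated_fourier R f \<xi> - g \<xi>)) \<longlongrightarrow> 0) at_top"
proof -
  have "(\<integral>\<^sup>+ \<xi>. ennreal ((cmod (truncated_fourier R f \<xi> - g \<xi>))\<^sup>2) \<partial>lebesgue) =
     ennreal (energy (\<lambda>\<xi>. truncated_fourier R f \<xi> - g \<xi>))"
    if "square_integrable f" "square_integrable g" for R
    using square_integrable_diff [OF truncated_fourier_plancherel(1) [OF that(1)] that(2)]
    by (simp add: nn_integral_completion energy_def square_integrable_def nn_integral_eq_integral)
  then show ?thesis
    unfolding has_fourier_def L2_iff_square_integrable [OF assms(1)] L2_iff_square_integrable [OF assms(2)]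
    by (auto simp: tendsto_ennreal_iff simp flip: ennreal_0)
qed

lemma energy_window_tendsto:
  assumes f: "square_integrable f"
  shows "((\<lambda>R. energy (\<lambda>x. indicator {-R..R} x * f x)) \<longlongrightarrow> energy f) at_top"
  unfolding energy_def
proof (rule integral_dominated_convergence_at_top)
  note [measurable] = square_integrable_measurable [OF f]
  show "integrable lborel (\<lambda>x. (cmod (f x))\<^sup>2)"
    using f by (simp add: square_integrable_def)
  show "\<forall>\<^sub>F R in at_top. AE x in lborel. norm ((cmod (indicator {-R..R} x * f x))\<^sup>2) \<le> (cmod (f x))\<^sup>2"
    by (intro always_eventually allI AE_I2) (auto simp: indicator_def)
  show "AE x in lborel. ((\<lambda>R. (cmod (indicator {-R..R} x * f x))\<^sup>2) \<longlongrightarrow> (cmod (f x))\<^sup>2) at_top"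
  proof (rule AE_I2, rule tendsto_eventually)
    show "\<forall>\<^sub>F R in at_top. (cmod (indicator {-R..R} x * f x))\<^sup>2 = (cmod (f x))\<^sup>2" for x
      using eventually_ge_at_top [of "\<bar>x\<bar>"] by eventually_elim (auto simp: indicator_def)
  qed
qed (use f in measurable)

text \<open>
  The truncations have the right energy by truncated_fourier_plancherel. The weighted triangle
  inequality gives each energy at most 1 + \<eta> times the other in the limit, for every \<eta> > 0.
\<close>

lemma plancherel:
  assumes fg: "has_fourier f g" and f: "f \<in> borel_measurable borel" and g: "g \<in> borel_measurable borel"
  shows "energy g = energy f"
proof -
  let ?d = "\<lambda>R. energy (\<lambda>\<xi>. truncated_fourier R f \<xi> - g \<xi>)"
  let ?a = "\<lambda>R. energy (\<lambda>x. indicator {-R..R} x * f x)"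
  have sf: "square_integrable f" and sg: "square_integrable g" and d: "(?d \<longlongrightarrow> 0) at_top"
    using fg unfolding has_fourier_iff [OF f g] by auto
  have a: "(?a \<longlongrightarrow> energy f) at_top"
    by (rule energy_window_tendsto [OF sf])
  have st: "square_integrable (truncated_fourier R f)" for R
    by (rule truncated_fourier_plancherel(1) [OF sf])
  have 1: "energy g \<le> (1 + \<eta>) * energy f" if "0 < \<eta>" for \<eta>
  proof (rule tendsto_lowerbound)
    show "((\<lambda>R. (1 + \<eta>) * ?a R + (1 + 1 / \<eta>) * ?d R) \<longlongrightarrow> (1 + \<eta>) * energy f) at_top"
      using tendsto_add [OF tendsto_mult_left [OF a, of "1 + \<eta>"] tendsto_mult_left [OF d, of "1 + 1 / \<eta>"]] by simp
    have "energy g \<le> (1 + \<eta>) * ?a R + (1 + 1 / \<eta>) * ?d R" for R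
      using energy_add_le_weighted [OF st [of R] square_integrable_diff [OF sg st [of R]] that]
      by (simp add: truncated_fourier_plancherel(2) [OF sf] energy_minus_commute [of g])
    then show "\<forall>\<^sub>F R in at_top. energy g \<le> (1 + \<eta>) * ?a R + (1 + 1 / \<eta>) * ?d R"
      by simp
  qed simp
  have 2: "energy f \<le> (1 + \<eta>) * energy g" if "0 < \<eta>" for \<eta>
  proof (rule tendsto_le [OF _ _ a])
    show "((\<lambda>R. (1 + \<eta>) * energy g + (1 + 1 / \<eta>) * ?d R) \<longlongrightarrow> (1 + \<eta>) * energy g) at_top"
      using tendsto_add [OF tendsto_const tendsto_mult_left [OF d, of "1 + 1 / \<eta>"]] by simp
    have "?a R \<le> (1 + \<eta>) * energy g + (1 + 1 / \<eta>) * ?d R" for R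
      using energy_add_le_weighted [OF sg square_integrable_diff [OF st [of R] sg] that]
      by (simp add: truncated_fourier_plancherel(2) [OF sf])
    then show "\<forall>\<^sub>F R in at_top. ?a R \<le> (1 + \<eta>) * energy g + (1 + 1 / \<eta>) * ?d R"
      by simp
  qed simp
  have lim: "x \<le> y" if "\<And>\<eta>. 0 < \<eta> \<Longrightarrow> x \<le> (1 + \<eta>) * y" for x y :: real
  proof (rule tendsto_lowerbound)
    have "((\<lambda>\<eta>. (1 + \<eta>) * y) \<longlongrightarrow> (1 + 0) * y) (at_right 0)"
      by (intro tendsto_intros)
    then show "((\<lambda>\<eta>. (1 + \<eta>) * y) \<longlongrightarrow> y) (at_right 0)" by simp
    show "\<forall>\<^sub>F \<eta> in at_right 0. x \<le> (1 + \<eta>) * y"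
      using that by (auto simp: eventually_at_right_less eventually_at_filter)
  qed simp
  show ?thesis
    using lim [OF 1] lim [OF 2] by (rule antisym)
qed

lemma truncated_fourier_linear:
  assumes f: "square_integrable f" and h: "square_integrable h"
  shows "truncated_fourier R (\<lambda>x. a * f x + b * h x) \<xi> = a * truncated_fourier R f \<xi> + b * truncated_fourier R h \<xi>"
proof -
  note [measurable] = square_integrable_measurable [OF f] square_integrable_measurable [OF h]
  have "fourier_integral (\<lambda>x. indicator {-R..R} x * (a * f x + b * h x)) \<xi> =
      (\<integral>x. a * (exp (- (\<i> * complex_of_real (x * \<xi>))) * (indicator {-R..R} x * f x)) +
            b * (exp (- (\<i> * complex_of_real (x * \<xi>))) * (indicator {-R..R} x * h x)) \<partial>lborel)"
    unfolding fourier_integral_def by (rule Bochner_Integration.integral_cong) (simp_all add: algebra_simps)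
  also have "\<dots> = a * fourier_integral (\<lambda>x. indicator {-R..R} x * f x) \<xi> + b * fourier_integral (\<lambda>x. indicator {-R..R} x * h x) \<xi>"
    unfolding fourier_integral_def
    by (subst Bochner_Integration.integral_add)
       (intro integrable_mult_right integrable_character_mult integrable_window f h | simp)+
  finally show ?thesis
    by (simp add: truncated_fourier_eq add_divide_distrib)
qed

lemma has_fourier_linear:
  assumes fg: "has_fourier f g" and [measurable]: "f \<in> borel_measurable borel" "g \<in> borel_measurable borel"
    and hk: "has_fourier h k" and [measurable]: "h \<in> borel_measurable borel" "k \<in> borel_measurable borel"
  shows "has_fourier (\<lambda>x. a * f x + b * h x) (\<lambda>\<xi>. a * g \<xi> + b * k \<xi>)"
proof -
  have f: "square_integrable f" and g: "square_integrable g"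
    and d: "((\<lambda>R. energy (\<lambda>\<xi>. truncated_fourier R f \<xi> - g \<xi>)) \<longlongrightarrow> 0) at_top"
    using fg by (auto simp: has_fourier_iff)
  have h: "square_integrable h" and k: "square_integrable k"
    and d': "((\<lambda>R. energy (\<lambda>\<xi>. truncated_fourier R h \<xi> - k \<xi>)) \<longlongrightarrow> 0) at_top"
    using hk by (auto simp: has_fourier_iff)
  let ?c = "\<lambda>R. 2 * ((cmod a)\<^sup>2 * energy (\<lambda>\<xi>. truncated_fourier R f \<xi> - g \<xi>)) +
                2 * ((cmod b)\<^sup>2 * energy (\<lambda>\<xi>. truncated_fourier R h \<xi> - k \<xi>))"
  have le: "energy (\<lambda>\<xi>. truncated_fourier R (\<lambda>x. a * f x + b * h x) \<xi> - (a * g \<xi> + b * k \<xi>)) \<le> ?c R" for R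
  proof -
    have "energy (\<lambda>\<xi>. truncated_fourier R (\<lambda>x. a * f x + b * h x) \<xi> - (a * g \<xi> + b * k \<xi>)) =
       energy (\<lambda>\<xi>. a * (truncated_fourier R f \<xi> - g \<xi>) + b * (truncated_fourier R h \<xi> - k \<xi>))"
      by (simp add: truncated_fourier_linear [OF f h] algebra_simps)
    also have "\<dots> \<le> 2 * energy (\<lambda>\<xi>. a * (truncated_fourier R f \<xi> - g \<xi>)) + 2 * energy (\<lambda>\<xi>. b * (truncated_fourier R h \<xi> - k \<xi>))"
      by (intro energy_add_le square_integrable_cmult square_integrable_diff truncated_fourier_plancherel f g h k)
    finally show ?thesis by (simp only: energy_cmult)
  qed
  have "(?c \<longlongrightarrow> 2 * ((cmod a)\<^sup>2 * 0) + 2 * ((cmod b)\<^sup>2 * 0)) at_top"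
    by (intro tendsto_intros d d')
  then have "(?c \<longlongrightarrow> 0) at_top" by simp
  then have "((\<lambda>R. energy (\<lambda>\<xi>. truncated_fourier R (\<lambda>x. a * f x + b * h x) \<xi> - (a * g \<xi> + b * k \<xi>))) \<longlongrightarrow> 0) at_top"
    by (rule tendsto_sandwich [OF _ _ tendsto_const, rotated 2]) (simp_all add: le)
  moreover have "square_integrable (\<lambda>x. a * f x + b * h x)" "square_integrable (\<lambda>\<xi>. a * g \<xi> + b * k \<xi>)"
    by (intro square_integrable_add square_integrable_cmult f g h k)+
  ultimately show ?thesis
    by (subst has_fourier_iff) auto
qed

text \<open>
  Already the truncated transforms are translates of each other, and translating preserves
  the distance of the approximation.
\<close>

lemma has_fourier_modulation:
  assumes fg: "has_fourier f g" and [measurable]: "f \<in> borel_measurable borel" "g \<in> borel_measurable borel"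
  shows "has_fourier (\<lambda>x. exp (\<i> * complex_of_real (k * x)) * f x) (\<lambda>\<xi>. g (\<xi> - k))"
proof -
  have f: "square_integrable f" and g: "square_integrable g"
    and d: "((\<lambda>R. energy (\<lambda>\<xi>. truncated_fourier R f \<xi> - g \<xi>)) \<longlongrightarrow> 0) at_top"
    using fg by (auto simp: has_fourier_iff)
  have tf: "truncated_fourier R (\<lambda>x. exp (\<i> * complex_of_real (k * x)) * f x) \<xi> = truncated_fourier R f (\<xi> - k)" for R \<xi>
  proof -
    have "exp (- (\<i> * complex_of_real (x * \<xi>))) * exp (\<i> * complex_of_real (k * x)) =
        exp (- (\<i> * complex_of_real (x * (\<xi> - k))))" for x
      by (simp add: exp_add [symmetric] algebra_simps)
    then show ?thesis
      unfolding truncated_fourier_def by (simp only: mult.assoc [symmetric])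
  qed
  have "energy (\<lambda>\<xi>. truncated_fourier R f (\<xi> - k) - g (\<xi> - k)) = energy (\<lambda>\<xi>. truncated_fourier R f \<xi> - g \<xi>)" for R
    using energy_translate [of "\<lambda>\<xi>. truncated_fourier R f \<xi> - g \<xi>" "- k"] by simp
  moreover have "square_integrable (\<lambda>x. exp (\<i> * complex_of_real (k * x)) * f x)"
    by (rule square_integrable_mult_bounded [OF f, where B = 1]) auto
  moreover have "square_integrable (\<lambda>\<xi>. g (\<xi> - k))"
    using square_integrable_translate [OF g, of "- k"] by simp
  ultimately show ?thesis
    using d by (subst has_fourier_iff) (auto simp: tf simp del: of_real_mult)
qed

text \<open>
  Plancherel's identity for f + h determines the real part of the inner product, and for
  f + \<i> h its imaginary part.
\<close>

lemma parseval:
  assumes fg: "has_fourier f g" and f [measurable]: "f \<in> borel_measurable borel" and g [measurable]: "g \<in> borel_measurable borel"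
    and hk: "has_fourier h k" and h [measurable]: "h \<in> borel_measurable borel" and k [measurable]: "k \<in> borel_measurable borel"
  shows "(\<integral>x. f x * cnj (h x) \<partial>lborel) = (\<integral>\<xi>. g \<xi> * cnj (k \<xi>) \<partial>lborel)"
proof -
  have sq: "square_integrable f" "square_integrable g" "square_integrable h" "square_integrable k"
    using fg hk by (auto simp: has_fourier_iff)
  have "Re (cnj z * (\<integral>x. f x * cnj (h x) \<partial>lborel)) = Re (cnj z * (\<integral>\<xi>. g \<xi> * cnj (k \<xi>) \<partial>lborel))" for z
  proof -
    have "has_fourier (\<lambda>x. f x + z * h x) (\<lambda>\<xi>. g \<xi> + z * k \<xi>)"
      using has_fourier_linear [OF fg f g hk h k, of 1 z] by simp
    then have "energy (\<lambda>\<xi>. g \<xi> + z * k \<xi>) = energy (\<lambda>x. f x + z * h x)"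
      by (rule plancherel) measurable
    then show ?thesis
      by (simp add: energy_add_polar sq plancherel [OF fg f g] plancherel [OF hk h k])
  qed
  from this [of 1] this [of \<i>] show ?thesis
    by (simp add: complex_eq_iff)
qed

lemma borel_representative:
  fixes f :: "real \<Rightarrow> complex"
  assumes f: "f \<in> borel_measurable lebesgue"
  obtains f' where "f' \<in> borel_measurable borel" "AE x in lebesgue. f x = f' x"
proof -
  have "(\<lambda>x. Re (f x)) \<in> borel_measurable lebesgue" "(\<lambda>x. Im (f x)) \<in> borel_measurable lebesgue"
    using f by measurable
  from completion_ex_borel_measurable_real [OF this(1)] completion_ex_borel_measurable_real [OF this(2)]
  obtain a b where a: "a \<in> borel_measurable lborel" "AE x in lborel. Re (f x) = a x"
    and b: "b \<in> borel_measurable lborel" "AE x in lborel. Im (f x) = b x"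
    by blast
  show thesis
  proof
    show "(\<lambda>x. Complex (a x) (b x)) \<in> borel_measurable borel"
      using a b by (simp add: borel_measurable_complex_iff)
    have "AE x in lborel. f x = Complex (a x) (b x)"
      using a(2) b(2) by eventually_elim (simp add: complex_eq_iff)
    then show "AE x in lebesgue. f x = Complex (a x) (b x)"
      by (rule AE_completion)
  qed
qed

lemma L2_cong_AE:
  assumes "f \<in> L2" and eq: "AE x in lebesgue. f x = f' x" and f': "f' \<in> borel_measurable borel"
  shows "f' \<in> L2"
proof -
  have [measurable]: "f \<in> borel_measurable lebesgue" "f' \<in> borel_measurable lebesgue"
    using assms by (simp_all add: L2_def measurable_completion)
  have "integrable lebesgue (\<lambda>x. (cmod (f x))\<^sup>2) \<longleftrightarrow> integrable lebesgue (\<lambda>x. (cmod (f' x))\<^sup>2)"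
    using eq by (intro integrable_cong_AE) auto
  then show ?thesis
    using assms(1) by (simp add: L2_def)
qed

lemma truncated_fourier_cong_AE:
  assumes "f \<in> L2" and eq: "AE x in lebesgue. f x = f' x" and f': "f' \<in> borel_measurable borel"
  shows "truncated_fourier R f = truncated_fourier R f'"
proof
  fix \<xi>
  have [measurable]: "f \<in> borel_measurable lebesgue" "f' \<in> borel_measurable lebesgue"
    using assms by (simp_all add: L2_def measurable_completion)
  have meas: "(\<lambda>x. exp (- (\<i> * complex_of_real (x * \<xi>)))) \<in> borel_measurable lebesgue"
    by (rule measurable_completion) measurable
  have "(LINT x:{-R..R}|lebesgue. exp (- (\<i> * complex_of_real (x * \<xi>))) * f x) =
        (LINT x:{-R..R}|lebesgue. exp (- (\<i> * complex_of_real (x * \<xi>))) * f' x)"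
    unfolding set_lebesgue_integral_def using eq
    by (intro integral_cong_AE borel_measurable_scaleR borel_measurable_times borel_measurable_indicator)
       (auto intro: meas simp del: of_real_mult)
  then show "truncated_fourier R f \<xi> = truncated_fourier R f' \<xi>"
    by (simp add: truncated_fourier_def)
qed

text \<open>
  Both sides of the transform relation see only classes of functions modulo null sets, so
  representatives may be assumed to be Borel measurable.
\<close>

lemma has_fourier_cong_AE:
  assumes fg: "has_fourier f g"
    and f: "AE x in lebesgue. f x = f' x" "f' \<in> borel_measurable borel"
    and g: "AE x in lebesgue. g x = g' x" "g' \<in> borel_measurable borel"
  shows "has_fourier f' g'"
proof -
  have L2: "f \<in> L2" "g \<in> L2"
    using fg by (simp_all add: has_fourier_def)
  have "(\<integral>\<^sup>+ \<xi>. ennreal ((cmod (truncated_fourier R f \<xi> - g \<xi>))\<^sup>2) \<partial>lebesgue) =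
        (\<integral>\<^sup>+ \<xi>. ennreal ((cmod (truncated_fourier R f' \<xi> - g' \<xi>))\<^sup>2) \<partial>lebesgue)" for R
    using g(1) by (intro nn_integral_cong_AE) (auto simp: truncated_fourier_cong_AE [OF L2(1) f])
  then show ?thesis
    using fg L2_cong_AE [OF L2(1) f] L2_cong_AE [OF L2(2) g] by (simp add: has_fourier_def)
qed

lemma L2_norm_on_eq:
  assumes eq: "AE x in lebesgue. u x = u' x" and u: "u \<in> borel_measurable lebesgue"
    and u' [measurable]: "u' \<in> borel_measurable borel" and A [measurable]: "A \<in> sets borel"
  shows "L2_norm_on A u = sqrt (energy (\<lambda>x. indicator A x * u' x))"
proof -
  have [measurable]: "u \<in> borel_measurable lebesgue" "u' \<in> borel_measurable lebesgue" "A \<in> sets lebesgue"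
    using u u' A by (simp_all add: measurable_completion)
  have "(LINT x:A|lebesgue. (cmod (u x))\<^sup>2) = (LINT x|lebesgue. (cmod (indicator A x * u' x))\<^sup>2)"
    unfolding set_lebesgue_integral_def
    by (intro integral_cong_AE borel_measurable_scaleR borel_measurable_times borel_measurable_indicator
        borel_measurable_power borel_measurable_norm)
       (use eq in \<open>auto simp: indicator_def\<close>)
  also have "\<dots> = energy (\<lambda>x. indicator A x * u' x)"
    unfolding energy_def by (rule integral_completion) measurable
  finally show ?thesis
    by (simp add: L2_norm_on_def)
qed

section \<open>A trigonometric minorant of a periodic open set\<close>

lemma power_times_quadratic_small:
  fixes q :: real
  assumes "0 < q" and "q < 1"
  shows "\<exists>N>0. q ^ N < 1 / (2 * real N * (real N + 1))"
proof -
  \<comment> \<open>The square root leaves one factor of geometric decay for each factor of N.\<close>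
  have "(\<lambda>N. real N * sqrt q ^ N) \<longlonglongrightarrow> 0"
    using assms powser_times_n_limit_0 [of "sqrt q"] by simp
  from tendsto_add [OF tendsto_mult [OF this this] tendsto_mult [OF this LIMSEQ_power_zero [of "sqrt q"]]]
  have "(\<lambda>N. real N * sqrt q ^ N * (real N * sqrt q ^ N) + real N * sqrt q ^ N * sqrt q ^ N) \<longlonglongrightarrow> 0"
    using assms by simp
  moreover have "real N * sqrt q ^ N * (real N * sqrt q ^ N) + real N * sqrt q ^ N * sqrt q ^ N = q ^ N * (real N * (real N + 1))" for N
  proof -
    have "sqrt q ^ N * sqrt q ^ N = q ^ N"
      using assms by (simp flip: power_mult_distrib)
    then show ?thesis
      by (simp add: algebra_simps)
  qed
  ultimately have "(\<lambda>N. 2 * (q ^ N * (real N * (real N + 1)))) \<longlonglongrightarrow> 2 * 0"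
    by (intro tendsto_mult_left) simp
  then have "(\<lambda>N. q ^ N * (2 * real N * (real N + 1))) \<longlonglongrightarrow> 0"
    by (simp add: algebra_simps)
  then have "\<forall>\<^sub>F N in sequentially. q ^ N * (2 * real N * (real N + 1)) < 1"
    by (rule order_tendstoD) simp
  then have "\<forall>\<^sub>F N in sequentially. 0 < N \<and> q ^ N * (2 * real N * (real N + 1)) < 1"
    using eventually_gt_at_top [of "0::nat"] by eventually_elim simp
  then obtain N where "0 < N" "q ^ N * (2 * real N * (real N + 1)) < 1"
    by (auto simp: eventually_sequentially)
  then show ?thesis
    by (intro exI [of _ N]) (simp add: pos_less_divide_eq)
qed

text \<open>
  The binomial coefficients decrease away from the centre, and neighbours of the centre are
  smaller by the factor N / (N + 1). That this gap shrinks only like 1 / N is what allows the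
  exponentially small correction in trigonometric_minorant.
\<close>

lemma noncentral_binomial_le:
  assumes "m \<noteq> N" and "m \<le> 2 * N"
  shows "real (2 * N choose m) \<le> real (2 * N choose N) * (real N / (real N + 1))"
proof -
  have N: "0 < N" using assms by auto
  have up: "(2 * N choose m) \<le> (2 * N choose Suc N)" if "Suc N \<le> m" "m \<le> 2 * N" for m
    by (rule binomial_antimono) (use that in auto)
  have "(2 * N choose m) \<le> (2 * N choose Suc N)"
  proof (cases "Suc N \<le> m")
    case False
    then have "(2 * N choose m) = (2 * N choose (2 * N - m))"
      using assms by (intro binomial_symmetric)
    also have "\<dots> \<le> (2 * N choose Suc N)"
      by (rule up) (use False assms in auto)
    finally show ?thesis .
  qed (use up assms in auto)
  then have "real (2 * N choose m) \<le> real (2 * N choose Suc N)"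
    by simp
  moreover have "Suc N * (2 * N choose Suc N) = N * (2 * N choose N)"
    using binomial_absorption [of N "2 * N"] binomial_absorb_comp [of "2 * N" N] N by simp
  then have "real (Suc N * (2 * N choose Suc N)) = real (N * (2 * N choose N))"
    by (rule arg_cong)
  then have "real (2 * N choose Suc N) = real (2 * N choose N) * (real N / (real N + 1))"
    unfolding of_nat_mult of_nat_Suc by (simp add: field_simps)
  ultimately show ?thesis
    by simp
qed

text \<open>
  With z = exp (\<i> y), the raised cosine is (1 + z)^2 / (4 z), and the binomial theorem applies to
  its N-th power.
\<close>

lemma raised_cosine_power_expansion:
  "complex_of_real (((1 + cos y) / 2) ^ N) =
    (\<Sum>m\<le>2 * N. of_real (real (2 * N choose m) / 4 ^ N) * exp (\<i> * of_real ((real m - real N) * y)))"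
proof -
  define z where "z = exp (\<i> * complex_of_real y)"
  have z: "z \<noteq> 0" by (simp add: z_def)
  have "complex_of_real (cos y) = (z + inverse z) / 2"
    by (simp add: z_def cos_exp_eq exp_minus flip: cos_of_real)
  moreover have "(1 + (z + inverse z) / 2) / 2 = (1 + z)\<^sup>2 / (4 * z)"
    using z by (simp add: field_simps power2_eq_square)
  ultimately have "complex_of_real ((1 + cos y) / 2) = (z + 1)\<^sup>2 / (4 * z)"
    by (simp only: of_real_divide of_real_add of_real_1 of_real_numeral add.commute)
  then have "complex_of_real (((1 + cos y) / 2) ^ N) = ((z + 1)\<^sup>2 / (4 * z)) ^ N"
    by (simp only: of_real_power)
  also have "\<dots> = (z + 1) ^ (2 * N) / (4 ^ N * z ^ N)"
    by (simp only: power_divide power_mult_distrib power_mult)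
  also have "\<dots> = (\<Sum>m\<le>2 * N. of_nat (2 * N choose m) * z ^ m / (4 ^ N * z ^ N))"
    by (simp add: binomial_ring sum_divide_distrib)
  also have "\<dots> = (\<Sum>m\<le>2 * N. of_real (real (2 * N choose m) / 4 ^ N) * exp (\<i> * of_real ((real m - real N) * y)))"
  proof (rule sum.cong [OF refl])
    fix m
    have "exp (\<i> * of_real ((real m - real N) * y)) = exp (of_nat m * (\<i> * of_real y) - of_nat N * (\<i> * of_real y))"
      by (simp add: algebra_simps)
    also have "\<dots> = z ^ m / z ^ N"
      by (simp only: exp_diff exp_of_nat_mult z_def)
    finally show "of_nat (2 * N choose m) * z ^ m / (4 ^ N * z ^ N) =
       of_real (real (2 * N choose m) / 4 ^ N) * exp (\<i> * of_real ((real m - real N) * y))"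
      by simp
  qed
  finally show ?thesis .
qed

text \<open>
  The N-th power of the raised cosine centred at a point x0 of \<Omega> has coefficients that are
  largest at frequency 0. Outside \<Omega>, hence at distance at least r from x0 modulo 2 pi, it
  is at most q ^ N with q < 1. Subtracting q ^ N makes it nonpositive there and lowers
  only the zeroth coefficient. The gap between that coefficient and the others decays
  like a power of N, so for large N it outweighs q ^ N.
\<close>

lemma trigonometric_minorant:
  fixes \<Omega> :: "real set"
  assumes "\<Omega> \<noteq> {}" and "open \<Omega>"
    and per: "\<And>k :: int. (\<lambda>x. x + 2 * pi * real_of_int k) ` \<Omega> = \<Omega>"
  obtains N :: nat and c :: "nat \<Rightarrow> complex" and \<kappa> :: real
  where "0 < \<kappa>" and "\<kappa> \<le> Re (c N)"
    and "\<And>m. m \<noteq> N \<Longrightarrow> m \<le> 2 * N \<Longrightarrow> cmod (c m) \<le> Re (c N) - \<kappa>"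
    and "\<And>x. Re (\<Sum>m\<le>2 * N. c m * exp (\<i> * of_real ((real m - real N) * x))) \<le> indicator \<Omega> x"
proof -
  obtain x0 where "x0 \<in> \<Omega>" using assms(1) by blast
  then obtain r' where "0 < r'" and r': "ball x0 r' \<subseteq> \<Omega>"
    using \<open>open \<Omega>\<close> by (auto simp: open_contains_ball)
  define r where "r = min r' 1"
  have r: "0 < r" "r \<le> 1" "ball x0 r \<subseteq> \<Omega>"
    using \<open>0 < r'\<close> r' by (auto simp: r_def)
  define q where "q = (1 + cos r) / 2"
  have "cos r < cos 0"
    by (rule cos_monotone_0_pi) (use r pi_gt3 in auto)
  moreover have "0 < cos r"
    by (rule cos_gt_zero_pi) (use r pi_gt3 in auto)
  ultimately have q: "0 < q" "q < 1" by (simp_all add: q_def)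
  have far: "cos (x - x0) \<le> cos r" if "x \<notin> \<Omega>" for x
  proof -
    \<comment> \<open>Reduction of x - x0 to a representative y in the interval from - pi to pi.\<close>
    define k where "k = round ((x - x0) / (2 * pi))"
    define y where "y = x - x0 - 2 * pi * real_of_int k"
    have "\<bar>real_of_int k - (x - x0) / (2 * pi)\<bar> \<le> 1 / 2"
      unfolding k_def by (rule of_int_round_abs_le)
    then have "\<bar>2 * pi * (real_of_int k - (x - x0) / (2 * pi))\<bar> \<le> pi"
      by (simp add: abs_mult)
    also have "2 * pi * (real_of_int k - (x - x0) / (2 * pi)) = - y"
      by (simp add: y_def field_simps)
    finally have ypi: "\<bar>y\<bar> \<le> pi" by simp
    have "r \<le> \<bar>y\<bar>"
    proof (rule ccontr)
      assume "\<not> r \<le> \<bar>y\<bar>"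
      then have "x0 + y \<in> \<Omega>"
        using r(3) by (auto simp: dist_real_def)
      then have "x0 + y + 2 * pi * real_of_int k \<in> \<Omega>"
        using per [of k] by blast
      then show False using that by (simp add: y_def)
    qed
    then have "cos \<bar>y\<bar> \<le> cos r"
      using r ypi by (intro cos_monotone_0_pi_le) auto
    moreover have "cos (x - x0) = cos (y + 2 * pi * real_of_int k)"
      by (simp add: y_def)
    then have "cos (x - x0) = cos y"
      by (simp add: cos_add)
    ultimately show ?thesis by simp
  qed
  obtain N where "0 < N" and qN: "q ^ N < 1 / (2 * real N * (real N + 1))"
    using power_times_quadratic_small [OF q] by blast
  define C where "C = real (2 * N choose N) / 4 ^ N"
  define \<kappa> where "\<kappa> = C / (real N + 1) - q ^ N"
  define c where "c m = of_real (real (2 * N choose m) / 4 ^ N) * exp (- (\<i> * of_real ((real m - real N) * x0)))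
      - (if m = N then of_real (q ^ N) else 0)" for m
  have "4 ^ N / (2 * real N) \<le> real (2 * N choose N)"
    by (rule central_binomial_lower_bound) fact
  then have C: "1 / (2 * real N) \<le> C"
    by (simp add: C_def field_simps)
  have ReN: "Re (c N) = C - q ^ N"
    by (simp add: c_def C_def)
  show thesis
  proof
    have "1 / (2 * real N) / (real N + 1) \<le> C / (real N + 1)"
      using C by (rule divide_right_mono) simp
    then show "0 < \<kappa>"
      using qN by (simp add: \<kappa>_def)
    have "C / (real N + 1) \<le> C / 1"
      by (rule divide_left_mono) (auto simp: C_def)
    then show "\<kappa> \<le> Re (c N)"
      by (simp add: \<kappa>_def ReN)
    show "cmod (c m) \<le> Re (c N) - \<kappa>" if "m \<noteq> N" "m \<le> 2 * N" for m
    proof -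
      have "cmod (c m) = real (2 * N choose m) / 4 ^ N"
        using that by (simp add: c_def norm_mult norm_divide norm_power del: of_real_mult of_real_diff)
      also have "\<dots> \<le> real (2 * N choose N) * (real N / (real N + 1)) / 4 ^ N"
        using noncentral_binomial_le [OF that] by (rule divide_right_mono) simp
      also have "\<dots> = C - C / (real N + 1)"
      proof -
        have "real N / (real N + 1) = 1 - 1 / (real N + 1)"
          by (simp add: field_simps)
        then show ?thesis
          by (simp add: C_def right_diff_distrib diff_divide_distrib)
      qed
      also have "\<dots> = Re (c N) - \<kappa>"
        by (simp add: ReN \<kappa>_def)
      finally show ?thesis .
    qed
    show "Re (\<Sum>m\<le>2 * N. c m * exp (\<i> * of_real ((real m - real N) * x))) \<le> indicator \<Omega> x" for x
    proof -
      have expand: "c m * exp (\<i> * of_real ((real m - real N) * x)) =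
          of_real (real (2 * N choose m) / 4 ^ N) * exp (\<i> * of_real ((real m - real N) * (x - x0)))
          - (if m = N then of_real (q ^ N) else 0)" for m
      proof -
        have "exp (- (\<i> * of_real ((real m - real N) * x0))) * exp (\<i> * of_real ((real m - real N) * x)) =
            exp (\<i> * complex_of_real ((real m - real N) * (x - x0)))"
          by (simp add: exp_add [symmetric] algebra_simps)
        then show ?thesis
          unfolding c_def left_diff_distrib mult.assoc by simp
      qed
      have "(\<Sum>m\<le>2 * N. c m * exp (\<i> * of_real ((real m - real N) * x))) =
          complex_of_real (((1 + cos (x - x0)) / 2) ^ N) - complex_of_real (q ^ N)"
        unfolding expand sum_subtractf raised_cosine_power_expansion by simp
      then have "Re (\<Sum>m\<le>2 * N. c m * exp (\<i> * of_real ((real m - real N) * x))) = ((1 + cos (x - x0)) / 2) ^ N - q ^ N"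
        by (simp only: minus_complex.simps Re_complex_of_real)
      also have "\<dots> \<le> indicator \<Omega> x"
      proof (cases "x \<in> \<Omega>")
        case True
        have "0 \<le> 1 + cos (x - x0)"
          using cos_ge_minus_one [of "x - x0"] by linarith
        then have "((1 + cos (x - x0)) / 2) ^ N \<le> 1"
          by (intro power_le_one) auto
        moreover have "0 \<le> q ^ N"
          using q by simp
        ultimately show ?thesis
          using True by simp
      next
        case False
        have "0 \<le> 1 + cos (x - x0)"
          using cos_ge_minus_one [of "x - x0"] by linarith
        then have "((1 + cos (x - x0)) / 2) ^ N \<le> q ^ N"
          using far [OF False] by (intro power_mono) (auto simp: q_def)
        then show ?thesis using False by simp
      qed
      finally show ?thesis .
    qed
  qed
qed

section \<open>Correlations of a function supported near two antipodal frequencies\<close>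

text \<open>
  For g the Fourier transform of u, this is the k-th Fourier moment of \<bar>u\<bar>^2 (lemma
  modulated_energy).
\<close>

definition shift_form :: "(real \<Rightarrow> complex) \<Rightarrow> real \<Rightarrow> complex" where
  "shift_form g k = (\<integral>\<xi>. g (\<xi> - k) * cnj (g \<xi>) \<partial>lborel)"

lemma square_integrable_shift: "square_integrable g \<Longrightarrow> square_integrable (\<lambda>\<xi>. g (\<xi> - k))"
  using square_integrable_translate [of g "- k"] by simp

lemma energy_shift: "energy (\<lambda>\<xi>. g (\<xi> - k)) = energy g"
  using energy_translate [of g "- k"] by simp

lemma shift_form_perturbation:
  assumes g: "square_integrable g" and h: "square_integrable h" and "0 < \<eta>"
  shows "cmod (shift_form (\<lambda>\<xi>. g \<xi> + h \<xi>) k - shift_form g k) \<le> \<eta> * energy g + (1 / \<eta> + 1) * energy h"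
proof -
  note gk = square_integrable_shift [OF g, of k] and hk = square_integrable_shift [OF h, of k]
  have young: "a * b \<le> \<eta> / 2 * a\<^sup>2 + 1 / (2 * \<eta>) * b\<^sup>2" for a b :: real
  proof -
    have "0 \<le> (\<eta> * a - b)\<^sup>2 / (2 * \<eta>)"
      using \<open>0 < \<eta>\<close> by simp
    also have "\<dots> = \<eta> / 2 * a\<^sup>2 + 1 / (2 * \<eta>) * b\<^sup>2 - a * b"
      using \<open>0 < \<eta>\<close> by (simp add: power2_eq_square field_simps)
    finally show ?thesis by simp
  qed
  let ?w = "\<lambda>\<xi>. (\<eta> / 2 * (cmod (g (\<xi> - k)))\<^sup>2 + 1 / (2 * \<eta>) * (cmod (h \<xi>))\<^sup>2) +
     ((\<eta> / 2 * (cmod (g \<xi>))\<^sup>2 + 1 / (2 * \<eta>) * (cmod (h (\<xi> - k)))\<^sup>2) +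
     (1 / 2 * (cmod (h (\<xi> - k)))\<^sup>2 + 1 / 2 * (cmod (h \<xi>))\<^sup>2))"
  have pt: "cmod ((a + b) * cnj (c + d) - a * cnj c) \<le>
      (\<eta> / 2 * (cmod a)\<^sup>2 + 1 / (2 * \<eta>) * (cmod d)\<^sup>2) + ((\<eta> / 2 * (cmod c)\<^sup>2 + 1 / (2 * \<eta>) * (cmod b)\<^sup>2) +
      (1 / 2 * (cmod b)\<^sup>2 + 1 / 2 * (cmod d)\<^sup>2))" for a b c d
  proof -
    have "(a + b) * cnj (c + d) - a * cnj c = a * cnj d + (b * cnj c + b * cnj d)"
      by (simp add: algebra_simps)
    then have "cmod ((a + b) * cnj (c + d) - a * cnj c) \<le> cmod (a * cnj d) + (cmod (b * cnj c) + cmod (b * cnj d))"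
      using norm_triangle_ineq [of "a * cnj d" "b * cnj c + b * cnj d"] norm_triangle_ineq [of "b * cnj c" "b * cnj d"]
      by simp
    also have "cmod (a * cnj d) \<le> \<eta> / 2 * (cmod a)\<^sup>2 + 1 / (2 * \<eta>) * (cmod d)\<^sup>2"
      using young [of "cmod a" "cmod d"] by (simp add: norm_mult)
    also have "cmod (b * cnj c) \<le> \<eta> / 2 * (cmod c)\<^sup>2 + 1 / (2 * \<eta>) * (cmod b)\<^sup>2"
      using young [of "cmod c" "cmod b"] by (simp add: norm_mult mult.commute)
    also have "cmod (b * cnj d) \<le> 1 / 2 * (cmod b)\<^sup>2 + 1 / 2 * (cmod d)\<^sup>2"
      using sum_squares_bound [of "cmod b" "cmod d"] by (simp add: norm_mult)
    finally show ?thesis by simp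
  qed
  have i1: "integrable lborel (\<lambda>\<xi>. (g (\<xi> - k) + h (\<xi> - k)) * cnj (g \<xi> + h \<xi>))"
    by (intro integrable_mult_cnj square_integrable_add g h gk hk)
  have i2: "integrable lborel (\<lambda>\<xi>. g (\<xi> - k) * cnj (g \<xi>))"
    by (intro integrable_mult_cnj g gk)
  have sq: "integrable lborel (\<lambda>\<xi>. (cmod (g \<xi>))\<^sup>2)" "integrable lborel (\<lambda>\<xi>. (cmod (h \<xi>))\<^sup>2)"
    "integrable lborel (\<lambda>\<xi>. (cmod (g (\<xi> - k)))\<^sup>2)" "integrable lborel (\<lambda>\<xi>. (cmod (h (\<xi> - k)))\<^sup>2)"
    using g h gk hk by (simp_all add: square_integrable_def)
  have "cmod (shift_form (\<lambda>\<xi>. g \<xi> + h \<xi>) k - shift_form g k) =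
      cmod (\<integral>\<xi>. (g (\<xi> - k) + h (\<xi> - k)) * cnj (g \<xi> + h \<xi>) - g (\<xi> - k) * cnj (g \<xi>) \<partial>lborel)"
    unfolding shift_form_def by (subst Bochner_Integration.integral_diff [OF i1 i2]) simp
  also have "\<dots> \<le> (\<integral>\<xi>. cmod ((g (\<xi> - k) + h (\<xi> - k)) * cnj (g \<xi> + h \<xi>) - g (\<xi> - k) * cnj (g \<xi>)) \<partial>lborel)"
    by (rule integral_norm_bound)
  also have "\<dots> \<le> integral\<^sup>L lborel ?w"
  proof (rule integral_mono)
    show "integrable lborel (\<lambda>\<xi>. cmod ((g (\<xi> - k) + h (\<xi> - k)) * cnj (g \<xi> + h \<xi>) - g (\<xi> - k) * cnj (g \<xi>)))"
      by (intro integrable_norm Bochner_Integration.integrable_diff i1 i2)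
    show "integrable lborel ?w"
      by (intro Bochner_Integration.integrable_add integrable_mult_right sq)
  qed (rule pt)
  also have "integral\<^sup>L lborel ?w = (\<eta> / 2 * energy (\<lambda>\<xi>. g (\<xi> - k)) + 1 / (2 * \<eta>) * energy h) +
     ((\<eta> / 2 * energy g + 1 / (2 * \<eta>) * energy (\<lambda>\<xi>. h (\<xi> - k))) +
     (1 / 2 * energy (\<lambda>\<xi>. h (\<xi> - k)) + 1 / 2 * energy h))"
    unfolding energy_def
    by (subst Bochner_Integration.integral_add; (intro Bochner_Integration.integrable_add integrable_mult_right sq)?)+
       (simp only: integral_mult_right_zero)
  also have "\<dots> = \<eta> * energy g + (1 / \<eta> + 1) * energy h"
    using \<open>0 < \<eta>\<close> by (simp add: energy_shift field_simps)
  finally show ?thesis .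
qed

text \<open>
  Each of the two intervals has length 2/5, so the differences between points of one and points of the
  other fill an interval of length 4/5, which contains at most one integer. For \<mu> \<ge> 1 the two
  intervals do not meet.
\<close>

definition shell :: "real \<Rightarrow> real set" where
  "shell \<mu> = {\<xi>. \<bar>\<bar>\<xi>\<bar> - \<mu>\<bar> < 1 / 5}"

lemma shell_borel [measurable]: "shell \<mu> \<in> sets borel"
  unfolding shell_def by measurable

text \<open>
  A nonzero integer is too large for \<xi> and \<xi> - j to lie in the same interval. So the two
  points have opposite signs and \<bar>j\<bar> is within 2/5 of 2 * \<mu>; since the sign of j is that of \<xi>, this
  leaves room for one integer only.
\<close>

lemma shell_translate_unique:
  assumes \<mu>: "1 \<le> \<mu>" and \<xi>: "\<xi> \<in> shell \<mu>"
    and j: "j \<noteq> 0" "\<xi> - real_of_int j \<in> shell \<mu>" and k: "k \<noteq> 0" "\<xi> - real_of_int k \<in> shell \<mu>"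
  shows "j = k"
proof -
  have opposite: "\<bar>\<bar>real_of_int i\<bar> - 2 * \<mu>\<bar> < 2 / 5 \<and> (0 < \<xi> \<longleftrightarrow> 0 < i)"
    if "i \<noteq> 0" "\<xi> - real_of_int i \<in> shell \<mu>" for i
  proof -
    have "1 \<le> \<bar>real_of_int i\<bar>"
      using that(1) by linarith
    then show ?thesis
      using \<mu> \<xi> that(2) unfolding shell_def mem_Collect_eq by (auto simp: abs_if split: if_splits)
  qed
  have close: "\<bar>a - b\<bar> < 1"
    if "\<bar>\<bar>a\<bar> - 2 * \<mu>\<bar> < 2 / 5" "\<bar>\<bar>b\<bar> - 2 * \<mu>\<bar> < 2 / 5" "0 < a \<longleftrightarrow> 0 < b" for a b :: real
    using that by (auto simp: abs_if split: if_splits)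
  have "\<bar>real_of_int j - real_of_int k\<bar> < 1"
    using opposite [OF j] opposite [OF k] by (intro close) auto
  then show ?thesis by linarith
qed

lemma sum_indicator_le_1:
  assumes "finite S" and "\<And>x y. x \<in> S \<Longrightarrow> y \<in> S \<Longrightarrow> P x \<Longrightarrow> P y \<Longrightarrow> x = y"
  shows "(\<Sum>x\<in>S. if P x then 1 else 0 :: real) \<le> 1"
proof -
  have "card {x \<in> S. P x} \<le> Suc 0"
    using assms by (subst card_le_Suc0_iff_eq) auto
  moreover have "(\<Sum>x\<in>S. if P x then 1 else 0 :: real) = real (card {x \<in> S. P x})"
    using assms(1) by (simp add: sum.If_cases Int_def)
  ultimately show ?thesis by simp
qed

text \<open>
  In the m-th integral only those \<xi> matter for which \<xi> and \<xi> - (m - N) both lie in the shell.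
  There the arithmetic-geometric mean inequality splits the product, and after a
  translation each half becomes an integral of \<bar>g\<bar>^2 over the points that have a partner in the
  shell. By shell_translate_unique every point has at most one partner in each
  direction, so the sum over m is bounded independently of N.
\<close>

lemma sum_shift_form_shell:
  assumes \<mu>: "1 \<le> \<mu>" and g: "square_integrable g" and supp: "\<And>\<xi>. \<xi> \<notin> shell \<mu> \<Longrightarrow> g \<xi> = 0"
  shows "(\<Sum>m\<in>{..2 * N} - {N}. cmod (shift_form g (real m - real N))) \<le> energy g"
proof -
  note [measurable] = square_integrable_measurable [OF g]
  let ?M = "{..2 * N} - {N}"
  define \<phi> where "\<phi> \<xi> = (if \<xi> \<in> shell \<mu> then 1 else 0 :: real)" for \<xi>
  have [measurable]: "\<phi> \<in> borel_measurable borel"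
    unfolding \<phi>_def by measurable
  have \<phi>: "0 \<le> \<phi> \<xi>" "\<phi> \<xi> \<le> 1" for \<xi>
    by (simp_all add: \<phi>_def)
  have int: "integrable lborel (\<lambda>\<xi>. (cmod (g \<xi>))\<^sup>2 * \<phi> (\<xi> + a))" for a
    by (rule Bochner_Integration.integrable_bound [of _ "\<lambda>\<xi>. (cmod (g \<xi>))\<^sup>2"])
       (use g \<phi> in \<open>auto simp: square_integrable_def abs_mult intro!: mult_left_le\<close>)
  have int2: "integrable lborel (\<lambda>\<xi>. (cmod (g \<xi>))\<^sup>2 * \<phi> (\<xi> + a) / 2 + (cmod (g \<xi>))\<^sup>2 * \<phi> (\<xi> - a) / 2)" for a
    using int [of a] int [of "- a"] by simp
  have bound: "cmod (shift_form g k) \<le> (\<integral>\<xi>. (cmod (g \<xi>))\<^sup>2 * \<phi> (\<xi> + k) / 2 + (cmod (g \<xi>))\<^sup>2 * \<phi> (\<xi> - k) / 2 \<partial>lborel)" for k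
  proof -
    have i1: "integrable lborel (\<lambda>\<xi>. (cmod (g (\<xi> - k)))\<^sup>2 * \<phi> \<xi> / 2)"
      using lborel_integrable_real_affine [OF int [of k], of 1 "- k"] by simp
    have i2: "integrable lborel (\<lambda>\<xi>. (cmod (g \<xi>))\<^sup>2 * \<phi> (\<xi> - k) / 2)"
      using int [of "- k"] by simp
    have "cmod (shift_form g k) \<le> (\<integral>\<xi>. cmod (g (\<xi> - k) * cnj (g \<xi>)) \<partial>lborel)"
      unfolding shift_form_def by (rule integral_norm_bound)
    also have "\<dots> \<le> (\<integral>\<xi>. (cmod (g (\<xi> - k)))\<^sup>2 * \<phi> \<xi> / 2 + (cmod (g \<xi>))\<^sup>2 * \<phi> (\<xi> - k) / 2 \<partial>lborel)"
    proof (rule integral_mono)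
      show "integrable lborel (\<lambda>\<xi>. cmod (g (\<xi> - k) * cnj (g \<xi>)))"
        by (intro integrable_norm integrable_mult_cnj square_integrable_shift g)
      show "integrable lborel (\<lambda>\<xi>. (cmod (g (\<xi> - k)))\<^sup>2 * \<phi> \<xi> / 2 + (cmod (g \<xi>))\<^sup>2 * \<phi> (\<xi> - k) / 2)"
        by (intro Bochner_Integration.integrable_add i1 i2)
      show "cmod (g (\<xi> - k) * cnj (g \<xi>)) \<le> (cmod (g (\<xi> - k)))\<^sup>2 * \<phi> \<xi> / 2 + (cmod (g \<xi>))\<^sup>2 * \<phi> (\<xi> - k) / 2" for \<xi>
        using sum_squares_bound [of "cmod (g (\<xi> - k))" "cmod (g \<xi>)"] supp [of \<xi>] supp [of "\<xi> - k"]
        by (auto simp: \<phi>_def norm_mult)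
    qed
    also have "\<dots> = (\<integral>\<xi>. (cmod (g (\<xi> - k)))\<^sup>2 * \<phi> \<xi> / 2 \<partial>lborel) + (\<integral>\<xi>. (cmod (g \<xi>))\<^sup>2 * \<phi> (\<xi> - k) / 2 \<partial>lborel)"
      by (rule Bochner_Integration.integral_add [OF i1 i2])
    also have "(\<integral>\<xi>. (cmod (g (\<xi> - k)))\<^sup>2 * \<phi> \<xi> / 2 \<partial>lborel) = (\<integral>\<xi>. (cmod (g \<xi>))\<^sup>2 * \<phi> (\<xi> + k) / 2 \<partial>lborel)"
      by (subst lborel_integral_real_affine [of 1 _ k]) (simp_all add: add.commute)
    also have "\<dots> + (\<integral>\<xi>. (cmod (g \<xi>))\<^sup>2 * \<phi> (\<xi> - k) / 2 \<partial>lborel) =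
        (\<integral>\<xi>. (cmod (g \<xi>))\<^sup>2 * \<phi> (\<xi> + k) / 2 + (cmod (g \<xi>))\<^sup>2 * \<phi> (\<xi> - k) / 2 \<partial>lborel)"
      using int [of k] i2 by (intro Bochner_Integration.integral_add [symmetric]) auto
    finally show ?thesis .
  qed
  have count: "(\<Sum>m\<in>?M. \<phi> (\<xi> + (real m - real N))) \<le> 1" "(\<Sum>m\<in>?M. \<phi> (\<xi> - (real m - real N))) \<le> 1"
    if \<xi>: "\<xi> \<in> shell \<mu>" for \<xi>
  proof -
    have inj: "m = n" if "m \<in> ?M" "n \<in> ?M" and e: "e = 1 \<or> e = - 1"
      and "\<xi> - real_of_int (e * (int m - int N)) \<in> shell \<mu>" "\<xi> - real_of_int (e * (int n - int N)) \<in> shell \<mu>" for m n e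
      using shell_translate_unique [OF \<mu> \<xi>, of "e * (int m - int N)" "e * (int n - int N)"] that by auto
    show "(\<Sum>m\<in>?M. \<phi> (\<xi> - (real m - real N))) \<le> 1"
      unfolding \<phi>_def by (rule sum_indicator_le_1) (use inj [of _ _ 1] in auto)
    show "(\<Sum>m\<in>?M. \<phi> (\<xi> + (real m - real N))) \<le> 1"
      unfolding \<phi>_def by (rule sum_indicator_le_1) (use inj [of _ _ "- 1"] in \<open>auto simp: algebra_simps\<close>)
  qed
  have "(\<Sum>m\<in>?M. cmod (shift_form g (real m - real N))) \<le>
      (\<Sum>m\<in>?M. \<integral>\<xi>. (cmod (g \<xi>))\<^sup>2 * \<phi> (\<xi> + (real m - real N)) / 2 + (cmod (g \<xi>))\<^sup>2 * \<phi> (\<xi> - (real m - real N)) / 2 \<partial>lborel)"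
    by (intro sum_mono bound)
  also have "\<dots> = (\<integral>\<xi>. (\<Sum>m\<in>?M. (cmod (g \<xi>))\<^sup>2 * \<phi> (\<xi> + (real m - real N)) / 2 + (cmod (g \<xi>))\<^sup>2 * \<phi> (\<xi> - (real m - real N)) / 2) \<partial>lborel)"
    by (intro Bochner_Integration.integral_sum [symmetric] int2)
  also have "\<dots> \<le> energy g"
    unfolding energy_def
  proof (rule integral_mono)
    show "integrable lborel (\<lambda>\<xi>. \<Sum>m\<in>?M. (cmod (g \<xi>))\<^sup>2 * \<phi> (\<xi> + (real m - real N)) / 2 + (cmod (g \<xi>))\<^sup>2 * \<phi> (\<xi> - (real m - real N)) / 2)"
      by (intro Bochner_Integration.integrable_sum int2)
    show "integrable lborel (\<lambda>\<xi>. (cmod (g \<xi>))\<^sup>2)"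
      using g by (simp add: square_integrable_def)
    fix \<xi>
    have "(\<Sum>m\<in>?M. (cmod (g \<xi>))\<^sup>2 * \<phi> (\<xi> + (real m - real N)) / 2 + (cmod (g \<xi>))\<^sup>2 * \<phi> (\<xi> - (real m - real N)) / 2)
       = (cmod (g \<xi>))\<^sup>2 * (((\<Sum>m\<in>?M. \<phi> (\<xi> + (real m - real N))) + (\<Sum>m\<in>?M. \<phi> (\<xi> - (real m - real N)))) / 2)"
      by (simp only: sum_distrib_left sum.distrib [symmetric] sum_divide_distrib add_divide_distrib distrib_left times_divide_eq_right)
    also have "\<dots> \<le> (cmod (g \<xi>))\<^sup>2"
    proof (cases "\<xi> \<in> shell \<mu>")
      case True
      then show ?thesis
        using count [OF True] by (intro mult_left_le) auto
    qed (simp add: supp)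
    finally show "(\<Sum>m\<in>?M. (cmod (g \<xi>))\<^sup>2 * \<phi> (\<xi> + (real m - real N)) / 2 + (cmod (g \<xi>))\<^sup>2 * \<phi> (\<xi> - (real m - real N)) / 2)
       \<le> (cmod (g \<xi>))\<^sup>2" .
  qed
  finally show ?thesis .
qed

section \<open>Observability and the resolvent estimate\<close>

lemma modulated_energy:
  assumes ug: "has_fourier u g" and [measurable]: "u \<in> borel_measurable borel" "g \<in> borel_measurable borel"
  shows "(\<integral>x. exp (\<i> * of_real (k * x)) * (u x * cnj (u x)) \<partial>lborel) = shift_form g k"
  using parseval [OF has_fourier_modulation [OF ug] _ _ ug, of k]
  by (simp add: shift_form_def mult.assoc)

lemma energy_split:
  assumes g: "square_integrable g" and [measurable]: "A \<in> sets borel"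
  shows "energy g = energy (\<lambda>x. indicator A x * g x) + energy (\<lambda>x. indicator (- A) x * g x)"
proof -
  have "square_integrable (\<lambda>x. indicator A x * g x)" "square_integrable (\<lambda>x. indicator (- A) x * g x)"
    by (auto intro: square_integrable_indicator [OF g])
  then have "energy (\<lambda>x. indicator A x * g x) + energy (\<lambda>x. indicator (- A) x * g x) =
      (\<integral>x. (cmod (indicator A x * g x))\<^sup>2 + (cmod (indicator (- A) x * g x))\<^sup>2 \<partial>lborel)"
    by (simp add: energy_def square_integrable_def)
  also have "\<dots> = energy g"
    unfolding energy_def by (rule Bochner_Integration.integral_cong) (auto simp: indicator_def)
  finally show ?thesis ..
qed

text \<open>
  The trigonometric polynomial of trigonometric_minorant is integrated against \<bar>u\<bar>^2. The constant
  depends on its coefficients only, hence on \<Omega> but not on \<mu>.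
\<close>

lemma observability_up_to_off_shell_frequencies:
  fixes \<Omega> :: "real set"
  assumes "\<Omega> \<noteq> {}" and "open \<Omega>"
    and per: "\<And>k :: int. (\<lambda>x. x + 2 * pi * real_of_int k) ` \<Omega> = \<Omega>"
  shows "\<exists>K>0. \<forall>\<mu>\<ge>1. \<forall>u g. has_fourier u g \<longrightarrow> u \<in> borel_measurable borel \<longrightarrow> g \<in> borel_measurable borel \<longrightarrow>
    energy u \<le> K * (energy (\<lambda>x. indicator \<Omega> x * u x) + energy (\<lambda>\<xi>. indicator (- shell \<mu>) \<xi> * g \<xi>))"
proof (rule trigonometric_minorant [OF assms])
  have [measurable]: "\<Omega> \<in> sets borel"
    using \<open>open \<Omega>\<close> by simp
  fix N :: nat and c :: "nat \<Rightarrow> complex" and \<kappa> :: real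
  assume \<kappa>: "0 < \<kappa>" "\<kappa> \<le> Re (c N)"
    and cm: "\<And>m. m \<noteq> N \<Longrightarrow> m \<le> 2 * N \<Longrightarrow> cmod (c m) \<le> Re (c N) - \<kappa>"
    and minorant: "\<And>x. Re (\<Sum>m\<le>2 * N. c m * exp (\<i> * of_real ((real m - real N) * x))) \<le> indicator \<Omega> x"
  define M where "M = (\<Sum>m\<le>2 * N. cmod (c m))"
  have "cmod (c N) \<le> M"
    unfolding M_def by (rule member_le_sum) auto
  then have "0 < M"
    using \<kappa> complex_Re_le_cmod [of "c N"] by linarith
  \<comment> \<open>With this value the perturbation absorbs half of the lower bound for the energy of g1.\<close>
  define \<eta> where "\<eta> = \<kappa> / (2 * M)"
  have \<eta>: "0 < \<eta>" "M * \<eta> = \<kappa> / 2"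
    using \<kappa> \<open>0 < M\<close> by (simp_all add: \<eta>_def)
  define B where "B = M * (1 / \<eta> + 1)"
  have "0 < B"
    using \<open>0 < M\<close> \<eta> by (simp add: B_def add_pos_pos)
  define K where "K = 2 / \<kappa> + 2 * B / \<kappa> + 1"
  have main: "energy u \<le> K * (energy (\<lambda>x. indicator \<Omega> x * u x) + energy (\<lambda>\<xi>. indicator (- shell \<mu>) \<xi> * g \<xi>))"
    if \<mu>: "1 \<le> \<mu>" and ug: "has_fourier u g" and u [measurable]: "u \<in> borel_measurable borel"
      and g [measurable]: "g \<in> borel_measurable borel" for \<mu> u g
  proof -
    have su: "square_integrable u" and sg: "square_integrable g"
      using ug by (auto simp: has_fourier_iff)
    define g1 where "g1 \<xi> = indicator (shell \<mu>) \<xi> * g \<xi>" for \<xi>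
    define g2 where "g2 \<xi> = indicator (- shell \<mu>) \<xi> * g \<xi>" for \<xi>
    have g12: "g = (\<lambda>\<xi>. g1 \<xi> + g2 \<xi>)"
      by (auto simp: g1_def g2_def indicator_def)
    have s1: "square_integrable g1" and s2: "square_integrable g2"
      unfolding g1_def g2_def by (auto intro: square_integrable_indicator [OF sg])
    define U where "U = energy (\<lambda>x. indicator \<Omega> x * u x)"
    let ?e = "\<lambda>m x. exp (\<i> * of_real ((real m - real N) * x))"
    let ?I = "\<lambda>h m. shift_form h (real m - real N)"
    have iu: "integrable lborel (\<lambda>x. u x * cnj (u x))"
      by (rule integrable_mult_cnj [OF su su])
    have ie: "integrable lborel (\<lambda>x. c m * (?e m x * (u x * cnj (u x))))" for m
    proof -
      have "integrable lborel (\<lambda>x. ?e m x * (u x * cnj (u x)))"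
        by (rule Bochner_Integration.integrable_bound [OF iu]) (auto simp: norm_mult)
      then show ?thesis by (rule integrable_mult_right)
    qed
    have poly: "(\<Sum>m\<le>2 * N. c m * (?e m x * (u x * cnj (u x)))) = (\<Sum>m\<le>2 * N. c m * ?e m x) * of_real ((cmod (u x))\<^sup>2)" for x
      by (simp only: complex_norm_square sum_distrib_right mult.assoc)
    have "Re (\<Sum>m\<le>2 * N. c m * ?I g m) = Re (\<Sum>m\<le>2 * N. \<integral>x. c m * (?e m x * (u x * cnj (u x))) \<partial>lborel)"
      by (simp only: modulated_energy [OF ug u g] integral_mult_right_zero)
    also have "\<dots> = Re (\<integral>x. (\<Sum>m\<le>2 * N. c m * (?e m x * (u x * cnj (u x)))) \<partial>lborel)"
      using ie by (subst Bochner_Integration.integral_sum) auto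
    also have "\<dots> = (\<integral>x. Re (\<Sum>m\<le>2 * N. c m * (?e m x * (u x * cnj (u x)))) \<partial>lborel)"
      by (rule integral_Re [symmetric]) (intro Bochner_Integration.integrable_sum ie)
    also have "\<dots> \<le> U"
      unfolding U_def energy_def
    proof (rule integral_mono)
      show "integrable lborel (\<lambda>x. Re (\<Sum>m\<le>2 * N. c m * (?e m x * (u x * cnj (u x)))))"
        by (intro integrable_Re Bochner_Integration.integrable_sum ie)
      show "integrable lborel (\<lambda>x. (cmod (indicator \<Omega> x * u x))\<^sup>2)"
        using square_integrable_indicator [OF su, of \<Omega>] by (simp add: square_integrable_def)
      fix x
      have "Re (\<Sum>m\<le>2 * N. c m * (?e m x * (u x * cnj (u x)))) = Re (\<Sum>m\<le>2 * N. c m * ?e m x) * (cmod (u x))\<^sup>2"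
        unfolding poly by (simp only: times_complex.simps Re_complex_of_real Im_complex_of_real mult_zero_right diff_zero)
      also have "\<dots> \<le> indicator \<Omega> x * (cmod (u x))\<^sup>2"
        by (rule mult_right_mono [OF minorant]) simp
      also have "\<dots> = (cmod (indicator \<Omega> x * u x))\<^sup>2"
        by (simp add: indicator_def)
      finally show "Re (\<Sum>m\<le>2 * N. c m * (?e m x * (u x * cnj (u x)))) \<le> (cmod (indicator \<Omega> x * u x))\<^sup>2" .
    qed
    finally have upper: "Re (\<Sum>m\<le>2 * N. c m * ?I g m) \<le> U" .
    have pert: "cmod (\<Sum>m\<le>2 * N. c m * (?I g m - ?I g1 m)) \<le> M * (\<eta> * energy g1 + (1 / \<eta> + 1) * energy g2)"
    proof -
      have "cmod (c m * (?I g m - ?I g1 m)) \<le> cmod (c m) * (\<eta> * energy g1 + (1 / \<eta> + 1) * energy g2)" for m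
        using mult_left_mono [OF shift_form_perturbation [OF s1 s2 \<eta>(1), of "real m - real N"] norm_ge_zero [of "c m"]]
        by (simp only: norm_mult g12)
      then show ?thesis
        unfolding M_def sum_distrib_right by (intro sum_norm_le) auto
    qed
    have lower: "\<kappa> * energy g1 \<le> Re (\<Sum>m\<le>2 * N. c m * ?I g1 m)"
    proof -
      let ?M = "{..2 * N} - {N}"
      have diag: "?I g1 N = of_real (energy g1)"
        by (simp only: shift_form_def energy_def diff_self diff_zero complex_norm_square flip: integral_complex_of_real)
      have "(\<Sum>m\<in>?M. cmod (c m * ?I g1 m)) \<le> (\<Sum>m\<in>?M. (Re (c N) - \<kappa>) * cmod (?I g1 m))"
        unfolding norm_mult by (intro sum_mono mult_right_mono cm) auto
      also have "\<dots> = (Re (c N) - \<kappa>) * (\<Sum>m\<in>?M. cmod (?I g1 m))"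
        by (simp only: sum_distrib_left)
      also have "\<dots> \<le> (Re (c N) - \<kappa>) * energy g1"
        using \<kappa> by (intro mult_left_mono sum_shift_form_shell [OF \<mu> s1]) (auto simp: g1_def)
      finally have "cmod (\<Sum>m\<in>?M. c m * ?I g1 m) \<le> (Re (c N) - \<kappa>) * energy g1"
        by (rule order_trans [OF norm_sum])
      then have "- ((Re (c N) - \<kappa>) * energy g1) \<le> Re (\<Sum>m\<in>?M. c m * ?I g1 m)"
        using abs_Re_le_cmod [of "\<Sum>m\<in>?M. c m * ?I g1 m"] by linarith
      moreover have "(\<Sum>m\<le>2 * N. c m * ?I g1 m) = c N * ?I g1 N + (\<Sum>m\<in>?M. c m * ?I g1 m)"
        by (rule sum.remove) auto
      then have "Re (\<Sum>m\<le>2 * N. c m * ?I g1 m) = Re (c N) * energy g1 + Re (\<Sum>m\<in>?M. c m * ?I g1 m)"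
        by (simp only: diag plus_complex.simps times_complex.simps Re_complex_of_real Im_complex_of_real mult_zero_right diff_zero)
      ultimately show ?thesis
        by (simp add: left_diff_distrib)
    qed
    have "(\<Sum>m\<le>2 * N. c m * ?I g m) = (\<Sum>m\<le>2 * N. c m * ?I g1 m) + (\<Sum>m\<le>2 * N. c m * (?I g m - ?I g1 m))"
      by (simp add: right_diff_distrib sum_subtractf)
    then have "\<kappa> * energy g1 - M * (\<eta> * energy g1 + (1 / \<eta> + 1) * energy g2) \<le> U"
      using upper lower pert abs_Re_le_cmod [of "\<Sum>m\<le>2 * N. c m * (?I g m - ?I g1 m)"] by simp
    moreover have "M * (\<eta> * energy g1 + (1 / \<eta> + 1) * energy g2) = \<kappa> / 2 * energy g1 + B * energy g2"
      by (simp add: B_def distrib_left \<eta>(2) flip: mult.assoc)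
    ultimately have "\<kappa> / 2 * energy g1 \<le> U + B * energy g2"
      by (simp add: field_simps)
    then have "energy g1 \<le> 2 / \<kappa> * U + 2 * B / \<kappa> * energy g2"
      using \<kappa>(1) by (simp add: field_simps)
    moreover have "energy u = energy g1 + energy g2"
      unfolding plancherel [OF ug u g, symmetric] g1_def g2_def by (rule energy_split [OF sg]) measurable
    ultimately have "energy u \<le> 2 / \<kappa> * U + (2 * B / \<kappa> + 1) * energy g2"
      by (simp add: distrib_right)
    also have "\<dots> \<le> K * U + K * energy g2"
      using \<kappa>(1) \<open>0 < B\<close> by (intro add_mono mult_right_mono) (auto simp: K_def U_def)
    finally show ?thesis
      by (simp only: U_def g2_def [abs_def] distrib_left)
  qed
  have "0 < K"
    using \<kappa>(1) \<open>0 < B\<close> by (simp add: K_def add_pos_pos)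
  with main show ?thesis by blast
qed

text \<open>
  After division by \<mu> powr s the claim concerns (r / \<mu>) powr s, where r / \<mu> is at distance at least
  y = 1 / (5 * \<mu>) from 1. Both cases follow from the tangent inequalities of the exponential and the
  logarithm; the constant is chosen to serve both.
\<close>

lemma powr_gap:
  fixes s \<mu> r :: real
  assumes "0 < s" and "1 \<le> \<mu>" and "0 \<le> r" and gap: "1 / 5 \<le> \<bar>r - \<mu>\<bar>"
  shows "s / (10 * (1 + s)) * \<mu> powr (s - 1) \<le> \<bar>r powr s - \<mu> powr s\<bar>"
proof -
  define y where "y = 1 / (5 * \<mu>)"
  have y: "0 < y" "y \<le> 1 / 5" and \<mu>y: "\<mu> * y = 1 / 5"
    using \<open>1 \<le> \<mu>\<close> by (simp_all add: y_def field_simps)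
  have lhs: "s / (10 * (1 + s)) * \<mu> powr (s - 1) = \<mu> powr s * (s * y / (2 * (1 + s)))"
    using \<open>1 \<le> \<mu>\<close> \<open>0 < s\<close> by (simp add: y_def powr_diff field_simps)
  have "s * y / (2 * (1 + s)) \<le> \<bar>r powr s / \<mu> powr s - 1\<bar>"
  proof (cases "\<mu> \<le> r")
    case True
    have "y / (2 * (1 + s)) \<le> y / (1 + y)"
      using y \<open>0 < s\<close> by (intro divide_left_mono) auto
    then have "s * y / (2 * (1 + s)) \<le> s * (y / (1 + y))"
      using mult_left_mono [of "y / (2 * (1 + s))" "y / (1 + y)" s] \<open>0 < s\<close> by simp
    also have "y / (1 + y) \<le> ln (1 + y)"
      using ln_le_minus_one [of "1 / (1 + y)"] y by (simp add: ln_div field_simps)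
    then have "s * (y / (1 + y)) \<le> s * ln (1 + y)"
      by (rule mult_left_mono) (use \<open>0 < s\<close> in simp)
    also have "\<dots> \<le> exp (s * ln (1 + y)) - 1"
      using exp_ge_add_one_self [of "s * ln (1 + y)"] by linarith
    also have "\<dots> = (1 + y) powr s - 1"
      using y by (simp add: powr_def)
    also have "\<dots> \<le> (r / \<mu>) powr s - 1"
    proof -
      have "1 + y \<le> r / \<mu>"
        using gap True \<open>1 \<le> \<mu>\<close> \<mu>y by (simp add: field_simps)
      then show ?thesis
        using y \<open>0 < s\<close> by (simp add: powr_mono2)
    qed
    also have "\<dots> \<le> \<bar>r powr s / \<mu> powr s - 1\<bar>"
      using \<open>0 \<le> r\<close> \<open>1 \<le> \<mu>\<close> by (simp add: powr_divide)
    finally show ?thesis .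
  next
    case False
    have sy: "0 < s * y" "s * y \<le> s"
      using y \<open>0 < s\<close> by simp_all
    have "1 + s * y \<le> 2 * (1 + s)"
      using add_mono [OF sy(2) less_imp_le [OF \<open>0 < s\<close>]] by simp
    then have "s * y / (2 * (1 + s)) \<le> s * y / (1 + s * y)"
      by (rule divide_left_mono) (use sy \<open>0 < s\<close> in auto)
    also have "\<dots> = 1 - 1 / (1 + s * y)"
      using sy by (simp add: field_simps)
    also have "\<dots> \<le> 1 - exp (- (s * y))"
    proof -
      have "1 / exp (s * y) \<le> 1 / (1 + s * y)"
        using sy exp_ge_add_one_self [of "s * y"] by (intro divide_left_mono) auto
      then show ?thesis by (simp add: exp_minus inverse_eq_divide)
    qed
    also have "\<dots> \<le> 1 - (1 - y) powr s"
    proof -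
      have "ln (1 - y) \<le> - y"
        using ln_le_minus_one [of "1 - y"] y by simp
      then have "s * ln (1 - y) \<le> - (s * y)"
        using mult_left_mono [of "ln (1 - y)" "- y" s] \<open>0 < s\<close> by simp
      then show ?thesis
        using y by (simp add: powr_def)
    qed
    also have "\<dots> \<le> 1 - (r / \<mu>) powr s"
    proof -
      have "r / \<mu> \<le> 1 - y"
        using gap False \<open>1 \<le> \<mu>\<close> \<mu>y by (simp add: field_simps)
      then show ?thesis
        using \<open>0 \<le> r\<close> \<open>1 \<le> \<mu>\<close> \<open>0 < s\<close> by (simp add: powr_mono2)
    qed
    also have "\<dots> \<le> \<bar>r powr s / \<mu> powr s - 1\<bar>"
      using \<open>0 \<le> r\<close> \<open>1 \<le> \<mu>\<close> by (simp add: powr_divide)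
    finally show ?thesis .
  qed
  then have "\<mu> powr s * (s * y / (2 * (1 + s))) \<le> \<mu> powr s * \<bar>r powr s / \<mu> powr s - 1\<bar>"
    by (rule mult_left_mono) simp
  also have "\<dots> = \<bar>\<mu> powr s * (r powr s / \<mu> powr s - 1)\<bar>"
    by (simp add: abs_mult)
  also have "\<mu> powr s * (r powr s / \<mu> powr s - 1) = r powr s - \<mu> powr s"
    using \<open>1 \<le> \<mu>\<close> by (simp add: field_simps)
  finally show ?thesis
    unfolding lhs .
qed

text \<open>
  The bracket lies between l and 2 * l. The factor 2 is needed for negative exponents,
  and the bound on the exponent keeps it from growing.
\<close>

lemma powr_le_japanese_bracket_powr:
  assumes "1 \<le> l" and "- 1 \<le> a"
  shows "l powr a \<le> 2 * japanese_bracket l powr a"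
proof (cases "0 \<le> a")
  case True
  have "l \<le> japanese_bracket l"
    using assms unfolding japanese_bracket_def by (intro real_le_rsqrt) simp
  then have "l powr a \<le> japanese_bracket l powr a"
    using assms True by (intro powr_mono2) auto
  also have "\<dots> \<le> 2 * japanese_bracket l powr a" by simp
  finally show ?thesis .
next
  case False
  have "1 + l\<^sup>2 \<le> (2 * l)\<^sup>2"
    using power_mono [OF assms(1), of 2] by (simp add: power_mult_distrib)
  then have "japanese_bracket l \<le> 2 * l"
    using assms unfolding japanese_bracket_def by (intro real_le_lsqrt) auto
  moreover have jp: "0 < japanese_bracket l"
    by (simp add: japanese_bracket_def add_pos_nonneg)
  ultimately have "l powr a \<le> (japanese_bracket l / 2) powr a"
    using False by (intro powr_mono2') auto
  also have "\<dots> = japanese_bracket l powr a * 2 powr (- a)"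
    using jp by (simp add: powr_divide powr_minus_divide)
  also have "\<dots> \<le> japanese_bracket l powr a * 2 powr 1"
    using assms by (intro mult_left_mono powr_mono) auto
  finally show ?thesis by simp
qed

theorem theorem4:
  fixes s :: real and \<Omega> :: "real set"
  assumes "s > 0"
    and "\<Omega> \<noteq> {}" and "open \<Omega>"
    and "\<And>k :: int. (\<lambda>x. x + 2 * pi * real_of_int k) ` \<Omega> = \<Omega>"
  shows "\<exists>C > 0. \<forall>l :: real. \<forall>u v f :: real \<Rightarrow> complex.
    l \<ge> 1 \<longrightarrow> u \<in> sobolev s \<longrightarrow> f \<in> L2 \<longrightarrow>
    has_frac_laplacian s u v \<longrightarrow>
    (AE x in lebesgue. v x - complex_of_real l * u x = f x) \<longrightarrow>
    L2_norm_on UNIV u \<le>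
      C * (japanese_bracket l powr (1 / s - 1) * L2_norm_on UNIV f + L2_norm_on \<Omega> u)"
proof -
  obtain K where "0 < K" and obs: "\<And>\<mu> u g. 1 \<le> \<mu> \<Longrightarrow> has_fourier u g \<Longrightarrow> u \<in> borel_measurable borel \<Longrightarrow> g \<in> borel_measurable borel \<Longrightarrow>
      energy u \<le> K * (energy (\<lambda>x. indicator \<Omega> x * u x) + energy (\<lambda>\<xi>. indicator (- shell \<mu>) \<xi> * g \<xi>))"
    using observability_up_to_off_shell_frequencies [OF assms(2-4)] by blast
  define a where "a = 10 * (1 + s) / s"
  have "0 < a" using \<open>s > 0\<close> by (simp add: a_def)
  define C where "C = sqrt K * (1 + 2 * a)"
  have "0 < C" using \<open>0 < K\<close> \<open>0 < a\<close> by (simp add: C_def)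
  have [measurable]: "\<Omega> \<in> sets borel"
    using \<open>open \<Omega>\<close> by simp
  have "L2_norm_on UNIV u \<le> C * (japanese_bracket l powr (1 / s - 1) * L2_norm_on UNIV f + L2_norm_on \<Omega> u)"
    if "1 \<le> l" and "f \<in> L2" and lap: "has_frac_laplacian s u v"
      and eqn: "AE x in lebesgue. v x - complex_of_real l * u x = f x" for l u v f
  proof -
    from lap obtain g where ug: "has_fourier u g"
      and vg: "has_fourier v (\<lambda>\<xi>. complex_of_real (\<bar>\<xi>\<bar> powr s) * g \<xi>)"
      unfolding has_frac_laplacian_def by blast
    have meas: "u \<in> borel_measurable lebesgue" "v \<in> borel_measurable lebesgue" "g \<in> borel_measurable lebesgue"
      "f \<in> borel_measurable lebesgue"
      using ug vg \<open>f \<in> L2\<close> by (auto simp: has_fourier_def L2_def)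
    obtain u' where u' [measurable]: "u' \<in> borel_measurable borel" and uu': "AE x in lebesgue. u x = u' x"
      using borel_representative [OF meas(1)] by blast
    obtain v' where v' [measurable]: "v' \<in> borel_measurable borel" and vv': "AE x in lebesgue. v x = v' x"
      using borel_representative [OF meas(2)] by blast
    obtain g' where g' [measurable]: "g' \<in> borel_measurable borel" and gg': "AE x in lebesgue. g x = g' x"
      using borel_representative [OF meas(3)] by blast
    define f' where "f' x = 1 * v' x + (- of_real l) * u' x" for x
    define h where "h \<xi> = 1 * (complex_of_real (\<bar>\<xi>\<bar> powr s) * g' \<xi>) + (- of_real l) * g' \<xi>" for \<xi>
    have f' [measurable]: "f' \<in> borel_measurable borel"
      unfolding f'_def by measurable
    have ff': "AE x in lebesgue. f x = f' x"
      using eqn uu' vv' by eventually_elim (simp add: f'_def)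
    have ug': "has_fourier u' g'"
      by (rule has_fourier_cong_AE [OF ug uu' u' gg' g'])
    have vg': "has_fourier v' (\<lambda>\<xi>. complex_of_real (\<bar>\<xi>\<bar> powr s) * g' \<xi>)"
    proof (rule has_fourier_cong_AE [OF vg vv' v'])
      show "AE \<xi> in lebesgue. complex_of_real (\<bar>\<xi>\<bar> powr s) * g \<xi> = complex_of_real (\<bar>\<xi>\<bar> powr s) * g' \<xi>"
        using gg' by eventually_elim simp
    qed measurable
    have fh: "has_fourier f' h"
      unfolding f'_def h_def by (rule has_fourier_linear [OF vg' v' _ ug' u' g']) measurable
    have h [measurable]: "h \<in> borel_measurable borel"
      unfolding h_def by measurable
    have sh: "square_integrable h" and sg': "square_integrable g'"
      using fh ug' by (auto simp: has_fourier_iff)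
    \<comment> \<open>The symbol equals l exactly at the frequencies of modulus \<mu>.\<close>
    define \<mu> where "\<mu> = l powr (1 / s)"
    have \<mu>: "1 \<le> \<mu>"
      using \<open>1 \<le> l\<close> \<open>s > 0\<close> by (simp add: \<mu>_def ge_one_powr_ge_zero)
    have \<mu>s: "\<mu> powr s = l"
      using \<open>1 \<le> l\<close> \<open>s > 0\<close> by (simp add: \<mu>_def powr_powr)
    define D where "D = a * l powr (1 / s - 1)"
    have "0 \<le> D" using \<open>0 < a\<close> by (simp add: D_def)
    have D: "D * (s / (10 * (1 + s)) * \<mu> powr (s - 1)) = 1"
    proof -
      have "l powr (1 / s - 1) * \<mu> powr (s - 1) = l powr ((1 / s - 1) + (1 / s) * (s - 1))"
        by (simp only: \<mu>_def powr_powr powr_add)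
      also have "(1 / s - 1) + (1 / s) * (s - 1) = 0"
        using \<open>s > 0\<close> by (simp add: field_simps)
      finally have "l powr (1 / s - 1) * \<mu> powr (s - 1) = 1"
        using \<open>1 \<le> l\<close> by simp
      moreover have "a * (s / (10 * (1 + s))) = 1"
        using \<open>s > 0\<close> by (simp add: a_def)
      moreover have "D * (s / (10 * (1 + s)) * \<mu> powr (s - 1)) = (a * (s / (10 * (1 + s)))) * (l powr (1 / s - 1) * \<mu> powr (s - 1))"
        by (simp only: D_def mult.assoc mult.left_commute)
      ultimately show ?thesis by (simp only: mult_1_right)
    qed
    have pt: "cmod (indicator (- shell \<mu>) \<xi> * g' \<xi>) \<le> cmod (of_real D * h \<xi>)" for \<xi>
    proof (cases "\<xi> \<in> shell \<mu>")
      case False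
      then have "1 / 5 \<le> \<bar>\<bar>\<xi>\<bar> - \<mu>\<bar>"
        by (simp add: shell_def)
      from mult_left_mono [OF powr_gap [OF \<open>s > 0\<close> \<mu> abs_ge_zero this] \<open>0 \<le> D\<close>]
      have "1 \<le> D * \<bar>\<bar>\<xi>\<bar> powr s - l\<bar>"
        unfolding D \<mu>s .
      then have "1 * cmod (g' \<xi>) \<le> D * \<bar>\<bar>\<xi>\<bar> powr s - l\<bar> * cmod (g' \<xi>)"
        by (rule mult_right_mono) simp
      also have "\<bar>\<bar>\<xi>\<bar> powr s - l\<bar> = cmod (complex_of_real (\<bar>\<xi>\<bar> powr s - l))"
        by (simp only: norm_of_real)
      also have "D * cmod (complex_of_real (\<bar>\<xi>\<bar> powr s - l)) * cmod (g' \<xi>) = cmod (of_real D * h \<xi>)"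
      proof -
        have "h \<xi> = complex_of_real (\<bar>\<xi>\<bar> powr s - l) * g' \<xi>"
          by (simp add: h_def left_diff_distrib)
        then show ?thesis
          using \<open>0 \<le> D\<close> by (simp only: norm_mult norm_of_real abs_of_nonneg mult.assoc)
      qed
      finally show ?thesis using False by simp
    qed simp
    have "energy (\<lambda>\<xi>. indicator (- shell \<mu>) \<xi> * g' \<xi>) \<le> energy (\<lambda>\<xi>. of_real D * h \<xi>)"
      unfolding energy_def
    proof (rule integral_mono)
      show "integrable lborel (\<lambda>\<xi>. (cmod (indicator (- shell \<mu>) \<xi> * g' \<xi>))\<^sup>2)"
        using square_integrable_indicator [OF sg', of "- shell \<mu>"] by (simp add: square_integrable_def)
      show "integrable lborel (\<lambda>\<xi>. (cmod (of_real D * h \<xi>))\<^sup>2)"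
        using square_integrable_cmult [OF sh, of "of_real D"] by (simp add: square_integrable_def)
    qed (rule power_mono [OF pt norm_ge_zero])
    also have "\<dots> = D\<^sup>2 * energy f'"
      by (simp add: energy_cmult plancherel [OF fh f' h])
    finally have off_shell: "energy (\<lambda>\<xi>. indicator (- shell \<mu>) \<xi> * g' \<xi>) \<le> D\<^sup>2 * energy f'" .
    define U where "U = energy (\<lambda>x. indicator \<Omega> x * u' x)"
    have "energy u' \<le> K * (U + D\<^sup>2 * energy f')"
      using obs [OF \<mu> ug' u' g'] off_shell \<open>0 < K\<close>
      by (auto simp: U_def intro: order_trans [OF _ mult_left_mono])
    then have "sqrt (energy u') \<le> sqrt (K * (U + D\<^sup>2 * energy f'))"
      by (rule real_sqrt_le_mono)
    also have "\<dots> = sqrt K * sqrt (U + D\<^sup>2 * energy f')"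
      by (rule real_sqrt_mult)
    also have "\<dots> \<le> sqrt K * (sqrt U + sqrt (D\<^sup>2 * energy f'))"
      using \<open>0 < K\<close> by (intro mult_left_mono sqrt_add_le_add_sqrt) (auto simp: U_def)
    also have "sqrt (D\<^sup>2 * energy f') = D * sqrt (energy f')"
      using \<open>0 \<le> D\<close> by (simp add: real_sqrt_mult)
    also have "sqrt K * (sqrt U + D * sqrt (energy f')) \<le>
        sqrt K * ((1 + 2 * a) * sqrt U + (1 + 2 * a) * (japanese_bracket l powr (1 / s - 1) * sqrt (energy f')))"
    proof (intro mult_left_mono add_mono)
      show "sqrt U \<le> (1 + 2 * a) * sqrt U"
        using \<open>0 < a\<close> by (simp add: U_def distrib_right)
      have "l powr (1 / s - 1) \<le> 2 * japanese_bracket l powr (1 / s - 1)"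
        using \<open>1 \<le> l\<close> \<open>s > 0\<close> by (intro powr_le_japanese_bracket_powr) auto
      then have "D \<le> a * (2 * japanese_bracket l powr (1 / s - 1))"
        unfolding D_def using \<open>0 < a\<close> by (intro mult_left_mono) auto
      also have "\<dots> \<le> (1 + 2 * a) * japanese_bracket l powr (1 / s - 1)"
        by (simp add: distrib_right)
      finally show "D * sqrt (energy f') \<le> (1 + 2 * a) * (japanese_bracket l powr (1 / s - 1) * sqrt (energy f'))"
        unfolding mult.assoc [symmetric] by (rule mult_right_mono) simp
    qed (use \<open>0 < K\<close> in simp)
    also have "\<dots> = C * (japanese_bracket l powr (1 / s - 1) * sqrt (energy f') + sqrt U)"
      by (simp only: C_def distrib_left [symmetric] mult.assoc add.commute)
    finally show ?thesis
      using L2_norm_on_eq [OF uu' meas(1) u', of UNIV] L2_norm_on_eq [OF ff' meas(4) f', of UNIV]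
        L2_norm_on_eq [OF uu' meas(1) u', of \<Omega>]
      by (simp add: U_def)
  qed
  with \<open>0 < C\<close> show ?thesis by blast
qed

end
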